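(* Let $\frac12<H<1$ and $\lambda>0$. The class of functions $$\mathcal A_1:=\Big\{f\in L^2(\mathbb R):\int_{\mathbb R}\Big|\big(\mathbb I_-^{H-\frac12,\lambda}f\big)(x)\Big|^2dx<\infty\Big\}$$ is a linear space with inner product $\langle f,g\rangle_{\mathcal A_1}:=\langle F,G\rangle_{L^2(\mathbb R)}$, where $$F(x)=\Gamma(H-\tfrac12)\big(\mathbb I_-^{H-\frac12,\lambda}f\big)(x),\qquad G(x)=\Gamma(H-\tfrac12)\big(\mathbb I_-^{H-\frac12,\lambda}g\big)(x).$$ The set $\mathcal E$ of elementary functions is dense in $\mathcal A_1$. The space $\mathcal A_1$ is not complete.
   Context: Functions are real-valued and identified when equal almost everywhere. The negative tempered fractional integral of order $\alpha>0$ is $\mathbb I^{\alpha,\lambda}_-f(t)=\frac1{\Gamma(\alpha)}\int_{-\infty}^\infty f(u)(u-t)_+^{\alpha-1}e^{-\lambda(u-t)_+}du$, where $(x)_+=x\,I(x>0)$ and the integrand vanishes for $u\le t$. An elementary function is a step function $f(u)=\sum_{i=1}^n a_i\mathbf 1_{[t_i,t_{i+1})}(u)$ with real $a_i,t_i$ and $t_i<t_j$ for $i<j$; $\mathcal E$ is the space of all of them. *)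

theory Defs
  imports "HOL-Analysis.Analysis"
begin

text \<open>
  Real functions on the line modulo equality almost everywhere. Borel representatives suffice:
  every Lebesgue measurable function agrees almost everywhere with a Borel measurable one.
\<close>

definition ae_eq :: "(real \<Rightarrow> real) \<Rightarrow> (real \<Rightarrow> real) \<Rightarrow> bool" where
  "ae_eq f g \<longleftrightarrow>
     f \<in> borel_measurable lborel \<and> g \<in> borel_measurable lborel \<and> (AE x in lborel. f x = g x)"

quotient_type aefun = "real \<Rightarrow> real" / partial: ae_eq
proof (rule part_equivpI)
  show "\<exists>f. ae_eq f f"
    by (rule exI[of _ "\<lambda>_. 0"]) (simp add: ae_eq_def)
  show "symp ae_eq"
    by (rule sympI) (auto simp: ae_eq_def elim: AE_mp)
  show "transp ae_eq"
  proof (rule transpI)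
    fix f g h assume "ae_eq f g" "ae_eq g h"
    then show "ae_eq f h"
      unfolding ae_eq_def by (auto elim: AE_mp)
  qed
qed

instantiation aefun :: real_vector
begin

lift_definition zero_aefun :: aefun is "\<lambda>_. 0"
  by (simp add: ae_eq_def)

lift_definition plus_aefun :: "aefun \<Rightarrow> aefun \<Rightarrow> aefun" is "\<lambda>f g x. f x + g x"
  by (auto simp: ae_eq_def)

lift_definition uminus_aefun :: "aefun \<Rightarrow> aefun" is "\<lambda>f x. - f x"
  by (auto simp: ae_eq_def)

lift_definition minus_aefun :: "aefun \<Rightarrow> aefun \<Rightarrow> aefun" is "\<lambda>f g x. f x - g x"
  by (auto simp: ae_eq_def)

lift_definition scaleR_aefun :: "real \<Rightarrow> aefun \<Rightarrow> aefun" is "\<lambda>c f x. c * f x"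
  by (auto simp: ae_eq_def)

instance
  by standard (transfer; auto simp: ae_eq_def algebra_simps)+

end

lift_definition square_integral :: "aefun \<Rightarrow> ennreal" is
  "\<lambda>f. \<integral>\<^sup>+x. ennreal (\<bar>f x\<bar>\<^sup>2) \<partial>lborel"
  by (auto simp: ae_eq_def intro!: nn_integral_cong_AE)

definition L2 :: "aefun set" where
  "L2 = {f. square_integral f < \<infinity>}"

lift_definition L2_inner :: "aefun \<Rightarrow> aefun \<Rightarrow> real" is
  "\<lambda>f g. LINT x|lborel. f x * g x"
  by (auto simp: ae_eq_def intro!: integral_cong_AE)

definition pos_part :: "real \<Rightarrow> real" where
  "pos_part x = (if x > 0 then x else 0)"

lemma pos_part_measurable [measurable]: "pos_part \<in> borel_measurable borel"
  unfolding pos_part_def[abs_def] by measurable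

text \<open>
  Since \<^term>\<open>0 powr a = (0::real)\<close>, the integrand vanishes for \<open>u \<le> t\<close>. The Bochner integral is
  \<open>0\<close> where it diverges; for \<open>\<alpha> > 0\<close>, \<open>lam > 0\<close> and square integrable \<open>f\<close> the kernel is integrable,
  so this concerns only a null set of \<open>t\<close>.
\<close>

lift_definition neg_tempered_integral :: "real \<Rightarrow> real \<Rightarrow> aefun \<Rightarrow> aefun" is
  "\<lambda>\<alpha> lam f t. 1 / Gamma \<alpha> *
     (LINT u|lborel. f u * pos_part (u - t) powr (\<alpha> - 1) * exp (- lam * pos_part (u - t)))"
proof -
  fix \<alpha> lam :: real and f g :: "real \<Rightarrow> real"
  assume "ae_eq f g"
  then have [measurable]: "f \<in> borel_measurable borel" "g \<in> borel_measurable borel"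
    and ae: "AE x in lborel. f x = g x"
    by (auto simp: ae_eq_def)
  have "(LINT u|lborel. f u * pos_part (u - t) powr (\<alpha> - 1) * exp (- lam * pos_part (u - t))) =
        (LINT u|lborel. g u * pos_part (u - t) powr (\<alpha> - 1) * exp (- lam * pos_part (u - t)))" for t
    by (rule integral_cong_AE) (use ae in auto)
  then show "ae_eq
     (\<lambda>t. 1 / Gamma \<alpha> *
        (LINT u|lborel. f u * pos_part (u - t) powr (\<alpha> - 1) * exp (- lam * pos_part (u - t))))
     (\<lambda>t. 1 / Gamma \<alpha> *
        (LINT u|lborel. g u * pos_part (u - t) powr (\<alpha> - 1) * exp (- lam * pos_part (u - t))))"
    unfolding ae_eq_def by simp
qed

definition A1 :: "real \<Rightarrow> real \<Rightarrow> aefun set" where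
  "A1 H lam = {f \<in> L2. square_integral (neg_tempered_integral (H - 1/2) lam f) < \<infinity>}"

definition A1_inner :: "real \<Rightarrow> real \<Rightarrow> aefun \<Rightarrow> aefun \<Rightarrow> real" where
  "A1_inner H lam f g =
     L2_inner (Gamma (H - 1/2) *\<^sub>R neg_tempered_integral (H - 1/2) lam f)
              (Gamma (H - 1/2) *\<^sub>R neg_tempered_integral (H - 1/2) lam g)"

definition A1_dist :: "real \<Rightarrow> real \<Rightarrow> aefun \<Rightarrow> aefun \<Rightarrow> real" where
  "A1_dist H lam f g = sqrt (A1_inner H lam (f - g) (f - g))"

definition is_inner_product_on :: "'a::real_vector set \<Rightarrow> ('a \<Rightarrow> 'a \<Rightarrow> real) \<Rightarrow> bool" where
  "is_inner_product_on V ip \<longleftrightarrow>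
     (\<forall>f\<in>V. \<forall>g\<in>V. ip f g = ip g f) \<and>
     (\<forall>f\<in>V. \<forall>g\<in>V. \<forall>h\<in>V. ip (f + g) h = ip f h + ip g h) \<and>
     (\<forall>c. \<forall>f\<in>V. \<forall>g\<in>V. ip (c *\<^sub>R f) g = c * ip f g) \<and>
     (\<forall>f\<in>V. 0 \<le> ip f f) \<and>
     (\<forall>f\<in>V. ip f f = 0 \<longrightarrow> f = 0)"

definition elementary :: "(real \<Rightarrow> real) \<Rightarrow> bool" where
  "elementary f \<longleftrightarrow>
     (\<exists>n\<ge>1. \<exists>(a :: nat \<Rightarrow> real) (t :: nat \<Rightarrow> real). strict_mono_on {1..n + 1} t \<and>
        f = (\<lambda>u. \<Sum>i = 1..n. a i * indicator {t i..<t (i + 1)} u))"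

lemma elementary_measurable: "elementary f \<Longrightarrow> f \<in> borel_measurable lborel"
  unfolding elementary_def by (elim exE conjE, hypsubst, measurable)

definition elementary_space :: "aefun set" where
  "elementary_space = abs_aefun ` {f. elementary f}"

end

theory Submission
  imports Defs
begin

text \<open>
  Put \<open>a = H - 1/2\<close> and \<open>k\<^sub>a(s) = s\<^sup>a\<^sup>-\<^sup>1 exp(- lam s)\<close> for \<open>s > 0\<close> and 0 otherwise. Up to the
  factor \<open>Gamma(a)\<close> the fractional integral is the operator \<open>T\<close> given by \<open>(T f)(t) = \<integral> f(u) k\<^sub>a(u - t) du\<close>,
  and the norm of the class is the \<open>L\<^sup>2\<close> norm of \<open>T f\<close>. The theorem rests on two properties
  of these kernels.

  Tempering makes \<open>k\<^sub>a\<close> integrable, so by Young's inequality (\<open>integral_corr_square_le\<close>) \<open>T\<close> is bounded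
  on \<open>L\<^sup>2\<close>. Hence the class is all of \<open>L\<^sup>2\<close> as a set (\<open>A1_eq_L2\<close>), and elementary functions are dense
  in it because they are dense in \<open>L\<^sup>2\<close> (\<open>sq_integrable_imp_step_approximable\<close>).

  The kernels form a semigroup up to constants, \<open>k\<^sub>a * k\<^sub>b = Beta(a, b) k\<^sub>a\<^sub>+\<^sub>b\<close>
  (\<open>integral_tempered_kernel_convolution\<close>). This is used twice, in place of Fourier analysis.
  Applying the operator of order \<open>1 - a\<close> to \<open>T f = 0\<close> gives \<open>\<integral>\<^sub>t\<^sup>\<infinity> f(u) exp(- lam u) du = 0\<close>
  for all \<open>t\<close>, so \<open>f = 0\<close> (\<open>corr_tempered_kernel_injective\<close>); this is the definiteness of the inner
  product. On the other hand, the reflection of \<open>k\<^sub>1\<^sub>/\<^sub>2\<close> is not square integrable, but \<open>T\<close> maps it to a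
  multiple of the reflection of \<open>k\<^sub>H\<close>, which is. Its truncations form a Cauchy
  sequence in the class, and injectivity rules out any limit (\<open>not_mcomplete_A1\<close>).
\<close>

section \<open>Square integrable functions on the line\<close>

definition sq_integrable :: "(real \<Rightarrow> real) \<Rightarrow> bool" where
  "sq_integrable f \<longleftrightarrow> f \<in> borel_measurable borel \<and> integrable lborel (\<lambda>x. (f x)\<^sup>2)"

lemma sq_integrable_measurable: "sq_integrable f \<Longrightarrow> f \<in> borel_measurable borel"
  by (simp add: sq_integrable_def)

lemma sq_integrable_mono:
  assumes "sq_integrable f" "g \<in> borel_measurable borel" "AE x in lborel. \<bar>g x\<bar> \<le> \<bar>f x\<bar>"
  shows "sq_integrable g"
  unfolding sq_integrable_def
proof
  show "integrable lborel (\<lambda>x. (g x)\<^sup>2)"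
  proof (rule Bochner_Integration.integrable_bound)
    show "integrable lborel (\<lambda>x. (f x)\<^sup>2)" using assms(1) by (simp add: sq_integrable_def)
    show "AE x in lborel. norm ((g x)\<^sup>2) \<le> norm ((f x)\<^sup>2)"
      using assms(3) by (auto simp: power2_abs abs_le_square_iff elim!: eventually_mono)
  qed (use assms(2) in measurable)
qed (rule assms(2))

lemma sq_integrable_scale: "sq_integrable f \<Longrightarrow> sq_integrable (\<lambda>x. c * f x)"
  unfolding sq_integrable_def by (auto simp: power_mult_distrib)

lemma sum_square_le: "(a + b)\<^sup>2 \<le> 2 * a\<^sup>2 + 2 * (b::real)\<^sup>2"
  using sum_squares_bound[of a b] by (simp add: power2_sum)

lemma sq_integrable_add:
  assumes "sq_integrable f" "sq_integrable g"
  shows "sq_integrable (\<lambda>x. f x + g x)"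
  unfolding sq_integrable_def
proof
  note [measurable] = assms[THEN sq_integrable_measurable]
  show "(\<lambda>x. f x + g x) \<in> borel_measurable borel" by measurable
  show "integrable lborel (\<lambda>x. (f x + g x)\<^sup>2)"
  proof (rule Bochner_Integration.integrable_bound)
    show "integrable lborel (\<lambda>x. 2 * (f x)\<^sup>2 + 2 * (g x)\<^sup>2)"
      using assms by (auto simp: sq_integrable_def)
  qed (auto simp: sum_square_le)
qed

lemma sq_integrable_diff:
  assumes "sq_integrable f" "sq_integrable g"
  shows "sq_integrable (\<lambda>x. f x - g x)"
  using sq_integrable_add[OF assms(1) sq_integrable_scale[OF assms(2), of "-1"]] by simp

lemma sq_integrable_mult:
  assumes "sq_integrable f" "sq_integrable g"
  shows "integrable lborel (\<lambda>x. f x * g x)"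
proof (rule Bochner_Integration.integrable_bound)
  note [measurable] = assms[THEN sq_integrable_measurable]
  show "integrable lborel (\<lambda>x. (f x)\<^sup>2 + (g x)\<^sup>2)"
    using assms by (auto simp: sq_integrable_def)
  show "(\<lambda>x. f x * g x) \<in> borel_measurable lborel" by measurable
  have "\<bar>a * b\<bar> \<le> a\<^sup>2 + b\<^sup>2" for a b :: real
    using sum_squares_bound[of "\<bar>a\<bar>" "\<bar>b\<bar>"] abs_ge_zero[of "a*b"] unfolding power2_abs abs_mult by linarith
  then show "AE x in lborel. norm (f x * g x) \<le> norm ((f x)\<^sup>2 + (g x)\<^sup>2)"
    by simp
qed

text \<open>
  The triangle inequality for the \<open>L\<^sup>2\<close> distance in squared form, with the factor 2 that
  \<open>(a + b)\<^sup>2 \<le> 2 a\<^sup>2 + 2 b\<^sup>2\<close> costs. For limit arguments this replaces Minkowski's inequality.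
\<close>

lemma square_dist_triangle:
  assumes "sq_integrable f" "sq_integrable g" "sq_integrable h"
  shows "(LINT x|lborel. (f x - h x)\<^sup>2)
    \<le> 2 * (LINT x|lborel. (f x - g x)\<^sup>2) + 2 * (LINT x|lborel. (g x - h x)\<^sup>2)"
proof -
  have i: "integrable lborel (\<lambda>x. (p x - q x)\<^sup>2)" if "sq_integrable p" "sq_integrable q" for p q
    using sq_integrable_diff[OF that] by (simp add: sq_integrable_def)
  have "(LINT x|lborel. (f x - h x)\<^sup>2) \<le> (LINT x|lborel. 2 * (f x - g x)\<^sup>2 + 2 * (g x - h x)\<^sup>2)"
    using sum_square_le[of "f x - g x" "g x - h x" for x]
    by (intro integral_mono) (auto intro!: i assms)
  also have "\<dots> = 2 * (LINT x|lborel. (f x - g x)\<^sup>2) + 2 * (LINT x|lborel. (g x - h x)\<^sup>2)"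
    by (subst Bochner_Integration.integral_add) (auto intro!: i assms)
  finally show ?thesis .
qed

text \<open>
  Dominated convergence in \<open>L\<^sup>2\<close>.
\<close>

lemma square_dist_tendsto_0:
  assumes w: "sq_integrable w" and f: "f \<in> borel_measurable borel"
    and U: "\<And>n. U n \<in> borel_measurable borel"
    and bound: "\<And>n. AE x in lborel. \<bar>f x - U n x\<bar> \<le> \<bar>w x\<bar>"
    and lim: "AE x in lborel. (\<lambda>n. U n x) \<longlonglongrightarrow> f x"
  shows "(\<lambda>n. LINT x|lborel. (f x - U n x)\<^sup>2) \<longlonglongrightarrow> 0"
proof -
  note [measurable] = f U
  have "(\<lambda>n. LINT x|lborel. (f x - U n x)\<^sup>2) \<longlonglongrightarrow> (LINT x|(lborel::real measure). 0)"
  proof (rule integral_dominated_convergence)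
    show "integrable lborel (\<lambda>x. (w x)\<^sup>2)" using w by (simp add: sq_integrable_def)
    show "AE x in lborel. (\<lambda>n. (f x - U n x)\<^sup>2) \<longlonglongrightarrow> 0"
      using lim
    proof eventually_elim
      case (elim x)
      then have "(\<lambda>n. (f x - U n x)\<^sup>2) \<longlonglongrightarrow> (f x - f x)\<^sup>2" by (intro tendsto_intros)
      then show ?case by simp
    qed
    show "AE x in lborel. norm ((f x - U n x)\<^sup>2) \<le> (w x)\<^sup>2" for n
      using bound[of n] by eventually_elim (simp add: abs_le_square_iff)
  qed simp_all
  then show ?thesis by simp
qed

section \<open>Elementary functions\<close>

text \<open>
  With step functions described by a set of breakpoints, which can be enlarged freely, a sum needs no
  common refinement of ordered partitions: the union of the breakpoint sets serves. The second clause
  makes \<open>f\<close> vanish before the first point of \<open>S\<close> and from the last one on.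
\<close>

definition steps_at :: "real set \<Rightarrow> (real \<Rightarrow> real) \<Rightarrow> bool" where
  "steps_at S f \<longleftrightarrow> finite S \<and>
     (\<forall>u v. {s\<in>S. s \<le> u} = {s\<in>S. s \<le> v} \<longrightarrow> f u = f v) \<and>
     (\<forall>u. {s\<in>S. s \<le> u} = {} \<or> {s\<in>S. s \<le> u} = S \<longrightarrow> f u = 0)"

lemma steps_at_superset:
  assumes "steps_at S f" "S \<subseteq> T" "finite T"
  shows "steps_at T f"
proof -
  have r: "{s\<in>S. s \<le> u} = S \<inter> {s\<in>T. s \<le> u}" for u using assms(2) by auto
  show ?thesis
    unfolding steps_at_def
  proof (intro conjI allI impI)
    fix u v assume "{s \<in> T. s \<le> u} = {s \<in> T. s \<le> v}"
    then have "{s\<in>S. s \<le> u} = {s\<in>S. s \<le> v}" by (simp add: r)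
    then show "f u = f v" using assms(1) unfolding steps_at_def by blast
  next
    fix u assume "{s \<in> T. s \<le> u} = {} \<or> {s \<in> T. s \<le> u} = T"
    then have "{s\<in>S. s \<le> u} = {} \<or> {s\<in>S. s \<le> u} = S" using assms(2) r[of u] by auto
    then show "f u = 0" using assms(1) unfolding steps_at_def by blast
  qed (rule assms(3))
qed

lemma elementary_imp_steps_at:
  assumes "elementary f"
  shows "\<exists>S. steps_at S f"
proof -
  obtain n a t where t: "strict_mono_on {1..n + 1} (t :: nat \<Rightarrow> real)"
    and f: "f = (\<lambda>u. \<Sum>i = 1..n. a i * indicator {t i..<t (i + 1)} u)"
    using assms unfolding elementary_def by auto
  define S where "S = t ` {1..n + 1}"
  have mem: "u \<in> {t i..<t (i + 1)} \<longleftrightarrow> t i \<in> {s\<in>S. s \<le> u} \<and> t (i + 1) \<notin> {s\<in>S. s \<le> u}"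
    if "i \<in> {1..n}" for i u
    using that by (auto simp: S_def not_le)
  have "steps_at S f"
    unfolding steps_at_def
  proof (intro conjI allI impI)
    show "finite S" by (simp add: S_def)
  next
    fix u v assume "{s \<in> S. s \<le> u} = {s \<in> S. s \<le> v}"
    then show "f u = f v"
      unfolding f by (intro sum.cong refl) (use mem in \<open>simp only: indicator_def\<close>)
  next
    fix u assume u: "{s \<in> S. s \<le> u} = {} \<or> {s \<in> S. s \<le> u} = S"
    have "u \<notin> {t i..<t (i + 1)}" if i: "i \<in> {1..n}" for i
    proof -
      have "t i \<in> S" "t (i+1) \<in> S" using i by (auto simp: S_def)
      then show ?thesis using u mem[OF i, of u] by auto
    qed
    then show "f u = 0" unfolding f by (intro sum.neutral) (simp add: indicator_def)
  qed
  then show ?thesis ..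
qed

text \<open>
  The sorted enumeration of the breakpoints supplies the nodes \<open>t\<close>, and the coefficient on
  \<open>[t i, t (i + 1))\<close> is the value of \<open>f\<close> at its left end.
\<close>

lemma steps_at_imp_elementary:
  assumes "steps_at S f"
  shows "elementary f"
proof -
  \<comment> \<open>An elementary function needs at least one interval, hence at least two nodes; two spare points ensure this.\<close>
  define T where "T = S \<union> {0, 1}"
  have T: "steps_at T f" 
    using assms by (rule steps_at_superset) (use assms in \<open>simp_all add: T_def steps_at_def subset_insertI2 subset_insertI\<close>)
  then have fin: "finite T" by (simp add: steps_at_def)
  define xs where "xs = sorted_list_of_set T"
  have set_xs: "set xs = T" and srt: "sorted_wrt (<) xs"
    using fin by (auto simp: xs_def)
  have len: "length xs = card T" by (simp add: xs_def)
  have "card {0, 1::real} \<le> card T" by (rule card_mono[OF fin]) (auto simp: T_def)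
  then have len2: "2 \<le> length xs" by (simp add: len)
  define n where "n = length xs - 1"
  define t where "t i = xs ! (i - 1)" for i
  have n: "1 \<le> n" "length xs = n + 1" using len2 by (auto simp: n_def)
  have sm: "strict_mono_on {1..n+1} t"
    unfolding t_def using n
    by (intro strict_mono_onI sorted_wrt_nth_less[OF srt]) auto
  have tT: "T = t ` {1..n+1}"
  proof
    show "T \<subseteq> t ` {1..n+1}"
    proof
      fix x assume "x \<in> T"
      then obtain i where "i < n + 1" "xs ! i = x" 
        unfolding set_xs[symmetric] in_set_conv_nth n by auto
      then show "x \<in> t ` {1..n+1}" by (intro image_eqI[of _ _ "i + 1"]) (auto simp: t_def)
    qed
    show "t ` {1..n+1} \<subseteq> T"
      unfolding set_xs[symmetric] using n by (auto simp: t_def)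
  qed
  have le: "t i \<le> t j \<longleftrightarrow> i \<le> j" if "i \<in> {1..n+1}" "j \<in> {1..n+1}" for i j
    using strict_mono_on_leD[OF sm that] strict_mono_on_leD[OF sm that(2,1)] 
      strict_mono_onD[OF sm that(2,1)] by force
  have "f u = (\<Sum>i = 1..n. f (t i) * indicator {t i..<t (i + 1)} u)" for u
  proof (cases "t 1 \<le> u \<and> u < t (n + 1)")
    case True
    define j where "j = Max {i\<in>{1..n}. t i \<le> u}"
    have "j \<in> {i\<in>{1..n}. t i \<le> u}"
      unfolding j_def using True n by (intro Max_in) auto
    then have j: "j \<in> {1..n}" "t j \<le> u" by auto
    have up: "u < t (j + 1)"
    proof (rule ccontr)
      assume *: "\<not> u < t (j + 1)"
      then have "j + 1 \<noteq> n + 1" using True by (intro notI) simp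
      then have "j + 1 \<in> {i\<in>{1..n}. t i \<le> u}" using j * by auto
      then have "j + 1 \<le> j" unfolding j_def by (intro Max_ge) auto
      then show False by simp
    qed
    have lei: "t i \<le> u \<longleftrightarrow> i \<le> j" if "i \<in> {1..n+1}" for i
      using le[OF that, of j] le[OF that, of "j+1"] le[of "j+1" i] that j up
      by (cases "i \<le> j") auto
    have "{s\<in>T. s \<le> u} = {s\<in>T. s \<le> t j}"
      unfolding tT using lei le j by auto
    then have "f u = f (t j)" using T unfolding steps_at_def by blast
    moreover have "u \<in> {t i..<t (i + 1)} \<longleftrightarrow> i = j" if "i \<in> {1..n}" for i
      using lei[of i] lei[of "i+1"] that by (auto simp: not_le[symmetric])
    then have "(\<Sum>i = 1..n. f (t i) * indicator {t i..<t (i + 1)} u) = (\<Sum>i = 1..n. if i = j then f (t i) else 0)"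
      by (intro sum.cong refl) (auto simp: indicator_def)
    ultimately show ?thesis using j by simp
  next
    case False
    have "{s\<in>T. s \<le> u} = {} \<or> {s\<in>T. s \<le> u} = T"
    proof (cases "t 1 \<le> u")
      case True
      with False have "t (n+1) \<le> u" by simp
      then have "t i \<le> u" if "i \<in> {1..n+1}" for i
        using le[of i "n+1"] that by auto
      then have "{s\<in>T. s \<le> u} = T" unfolding tT by blast
      then show ?thesis ..
    next
      case 1: False
      then have "\<not> t i \<le> u" if "i \<in> {1..n+1}" for i
        using le[of 1 i] that by auto
      then have "{s\<in>T. s \<le> u} = {}" unfolding tT by blast
      then show ?thesis ..
    qed
    then have "f u = 0" using T unfolding steps_at_def by blast
    moreover have "u \<notin> {t i..<t (i + 1)}" if "i \<in> {1..n}" for i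
      using False le[of 1 i] le[of "i+1" "n+1"] that by auto
    then have "(\<Sum>i = 1..n. f (t i) * indicator {t i..<t (i + 1)} u) = 0"
      by (intro sum.neutral) (auto simp: indicator_def)
    ultimately show ?thesis by simp
  qed
  then have "f = (\<lambda>u. \<Sum>i = 1..n. f (t i) * indicator {t i..<t (i + 1)} u)" by (rule ext)
  then show ?thesis
    unfolding elementary_def by (intro exI[of _ n] conjI exI[of _ "\<lambda>i. f (t i)"] exI[of _ t] n(1) sm)
qed

lemma elementary_iff_steps_at: "elementary f \<longleftrightarrow> (\<exists>S. steps_at S f)"
  using elementary_imp_steps_at steps_at_imp_elementary by blast

lemma elementary_add:
  assumes "elementary f" "elementary g"
  shows "elementary (\<lambda>x. f x + g x)"
proof -
  obtain S T where "steps_at S f" "steps_at T g" using assms unfolding elementary_iff_steps_at by blast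
  moreover from this have "finite (S \<union> T)" by (simp add: steps_at_def)
  ultimately have "steps_at (S \<union> T) f" "steps_at (S \<union> T) g"
    using steps_at_superset[of S f "S \<union> T"] steps_at_superset[of T g "S \<union> T"] by simp_all
  note fg = this
  have "steps_at (S \<union> T) (\<lambda>x. f x + g x)"
    unfolding steps_at_def
  proof (intro conjI allI impI)
    show "finite (S \<union> T)" using fg by (simp add: steps_at_def)
  next
    fix u v assume "{s \<in> S \<union> T. s \<le> u} = {s \<in> S \<union> T. s \<le> v}"
    then have "f u = f v" "g u = g v" using fg unfolding steps_at_def by blast+
    then show "f u + g u = f v + g v" by simp
  next
    fix u assume "{s \<in> S \<union> T. s \<le> u} = {} \<or> {s \<in> S \<union> T. s \<le> u} = S \<union> T"
    then have "f u = 0" "g u = 0" using fg unfolding steps_at_def by blast+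
    then show "f u + g u = 0" by simp
  qed
  then show ?thesis by (rule steps_at_imp_elementary)
qed

lemma elementary_scale:
  assumes "elementary f"
  shows "elementary (\<lambda>x. c * f x)"
proof -
  obtain S where "steps_at S f" using assms unfolding elementary_iff_steps_at by blast
  note f = this
  have "steps_at S (\<lambda>x. c * f x)"
    unfolding steps_at_def
  proof (intro conjI allI impI)
    show "finite S" using f by (simp add: steps_at_def)
  next
    fix u v assume "{s \<in> S. s \<le> u} = {s \<in> S. s \<le> v}"
    then have "f u = f v" using f unfolding steps_at_def by blast
    then show "c * f u = c * f v" by simp
  next
    fix u assume "{s \<in> S. s \<le> u} = {} \<or> {s \<in> S. s \<le> u} = S"
    then have "f u = 0" using f unfolding steps_at_def by blast
    then show "c * f u = 0" by simp
  qed
  then show ?thesis by (rule steps_at_imp_elementary)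
qed

lemma elementary_indicator: "elementary (indicator {a..<b})"
proof (cases "a < b")
  case True
  then show ?thesis
    unfolding elementary_def
    by (intro exI[of _ 1] conjI exI[of _ "\<lambda>_. 1"] exI[of _ "\<lambda>i. if i = 1 then a else b"])
       (auto simp: strict_mono_on_def)
next
  case False
  then have "steps_at {} (indicator {a..<b})" by (simp add: steps_at_def)
  then show ?thesis by (rule steps_at_imp_elementary)
qed

lemma sq_integrable_indicator:
  assumes "A \<in> sets borel" "emeasure lborel A < \<infinity>"
  shows "sq_integrable (indicator A)"
proof -
  have "(\<lambda>x. (indicator A x :: real)\<^sup>2) = indicator A" by (auto simp: indicator_def)
  then show ?thesis
    using assms unfolding sq_integrable_def by (auto intro!: integrable_real_indicator)
qed

lemma elementary_sq_integrable:
  assumes "elementary f"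
  shows "sq_integrable f"
proof -
  obtain n a t where "strict_mono_on {1..n + 1} (t :: nat \<Rightarrow> real)"
    and f: "f = (\<lambda>u. \<Sum>i = 1..n. a i * indicator {t i..<t (i + 1)} u)"
    using assms unfolding elementary_def by auto
  have "sq_integrable (\<lambda>u. \<Sum>i = 1..(m::nat). a i * indicator {t i..<t (i + 1)} u)" for m
  proof (induction m)
    case 0 show ?case by (simp add: sq_integrable_def)
  next
    case (Suc m)
    then show ?case
      by (simp, intro sq_integrable_add sq_integrable_scale sq_integrable_indicator)
        (simp_all add: emeasure_bounded_finite[simplified])
  qed
  then show ?thesis by (simp add: f)
qed

section \<open>Density of the elementary functions in \<open>L\<^sup>2\<close>\<close>

text \<open>
  Membership in the \<open>L\<^sup>2\<close> closure of the elementary functions.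
\<close>

definition step_approximable :: "(real \<Rightarrow> real) \<Rightarrow> bool" where
  "step_approximable f \<longleftrightarrow> sq_integrable f \<and>
     (\<forall>\<epsilon>>0. \<exists>e. elementary e \<and> (LINT x|lborel. (f x - e x)\<^sup>2) < \<epsilon>)"

lemma elementary_step_approximable: "elementary f \<Longrightarrow> step_approximable f"
  unfolding step_approximable_def
  by (auto intro!: exI[of _ f] elementary_sq_integrable)

lemma step_approximable_limit:
  assumes f: "sq_integrable f" and U: "\<And>n. step_approximable (U n)"
    and lim: "(\<lambda>n. LINT x|lborel. (f x - U n x)\<^sup>2) \<longlonglongrightarrow> 0"
  shows "step_approximable f"
  unfolding step_approximable_def
proof (intro conjI allI impI)
  fix \<epsilon> :: real assume "0 < \<epsilon>"
  then have "\<forall>\<^sub>F n in sequentially. (LINT x|lborel. (f x - U n x)\<^sup>2) < \<epsilon> / 4"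
    using lim by (intro order_tendstoD) auto
  then obtain n where n: "(LINT x|lborel. (f x - U n x)\<^sup>2) < \<epsilon> / 4"
    by (auto simp: eventually_sequentially)
  obtain e where e: "elementary e" "(LINT x|lborel. (U n x - e x)\<^sup>2) < \<epsilon> / 4"
    using U[of n] \<open>0 < \<epsilon>\<close> unfolding step_approximable_def by (meson divide_pos_pos zero_less_numeral)
  have "sq_integrable (U n)" using U by (simp add: step_approximable_def)
  then have "(LINT x|lborel. (f x - e x)\<^sup>2) < \<epsilon>"
    using square_dist_triangle[OF f _ elementary_sq_integrable[OF e(1)], of "U n"] n e(2) by linarith
  then show "\<exists>e. elementary e \<and> (LINT x|lborel. (f x - e x)\<^sup>2) < \<epsilon>" using e(1) by blast
qed (rule f)

lemma step_approximable_add: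
  assumes "step_approximable f" "step_approximable g"
  shows "step_approximable (\<lambda>x. f x + g x)"
  unfolding step_approximable_def
proof (intro conjI allI impI)
  have f: "sq_integrable f" and g: "sq_integrable g"
    using assms by (auto simp: step_approximable_def)
  then show fg: "sq_integrable (\<lambda>x. f x + g x)" by (rule sq_integrable_add)
  fix \<epsilon> :: real assume "0 < \<epsilon>"
  then obtain e d where e: "elementary e" "(LINT x|lborel. (f x - e x)\<^sup>2) < \<epsilon> / 4"
    and d: "elementary d" "(LINT x|lborel. (g x - d x)\<^sup>2) < \<epsilon> / 4"
    using assms unfolding step_approximable_def by (meson divide_pos_pos zero_less_numeral)
  have "(LINT x|lborel. ((f x + g x) - (e x + d x))\<^sup>2)
      \<le> 2 * (LINT x|lborel. ((f x + g x) - (e x + g x))\<^sup>2) + 2 * (LINT x|lborel. ((e x + g x) - (e x + d x))\<^sup>2)"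
    using f g e d
    by (intro square_dist_triangle sq_integrable_add) (auto intro: elementary_sq_integrable)
  then have "(LINT x|lborel. ((f x + g x) - (e x + d x))\<^sup>2) < \<epsilon>" using e(2) d(2) by simp
  then show "\<exists>h. elementary h \<and> (LINT x|lborel. (f x + g x - h x)\<^sup>2) < \<epsilon>"
    using elementary_add[OF e(1) d(1)] by blast
qed

lemma step_approximable_scale:
  assumes "step_approximable f"
  shows "step_approximable (\<lambda>x. c * f x)"
  unfolding step_approximable_def
proof (intro conjI allI impI)
  show "sq_integrable (\<lambda>x. c * f x)"
    using assms by (auto simp: step_approximable_def intro: sq_integrable_scale)
  fix \<epsilon> :: real assume "0 < \<epsilon>"
  moreover have "0 < c\<^sup>2 + 1" by (simp add: add_nonneg_pos)
  ultimately obtain e where e: "elementary e" "(LINT x|lborel. (f x - e x)\<^sup>2) < \<epsilon> / (c\<^sup>2 + 1)"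
    using assms unfolding step_approximable_def by (meson divide_pos_pos)
  have "(LINT x|lborel. (c * f x - c * e x)\<^sup>2) = c\<^sup>2 * (LINT x|lborel. (f x - e x)\<^sup>2)"
    by (simp add: right_diff_distrib[symmetric] power_mult_distrib)
  also have "\<dots> \<le> (c\<^sup>2 + 1) * (LINT x|lborel. (f x - e x)\<^sup>2)"
    by (simp add: distrib_right)
  also have "\<dots> < \<epsilon>"
    using e(2) \<open>0 < c\<^sup>2 + 1\<close> by (simp add: pos_less_divide_eq mult.commute)
  finally show "\<exists>h. elementary h \<and> (LINT x|lborel. (c * f x - h x)\<^sup>2) < \<epsilon>"
    using elementary_scale[OF e(1)] by blast
qed

text \<open>
  A Dynkin class argument over the half lines \<open>(-\<infinity>, x)\<close>, which meet \<open>[a, b)\<close> in a half-open interval.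
  Staying inside \<open>[a, b)\<close> keeps complements in \<open>L\<^sup>2\<close> and gives the indicator of \<open>[a, b)\<close> as a common
  majorant, so that countable disjoint unions are covered by dominated convergence.
\<close>

lemma step_approximable_bounded_set:
  assumes "A \<in> sets borel"
  shows "step_approximable (indicator (A \<inter> {a..<b}))"
proof -
  let ?J = "{a..<b} :: real set"
  have fin: "emeasure lborel (B \<inter> ?J) < \<infinity>" for B :: "real set"
  proof -
    have "emeasure lborel (B \<inter> ?J) \<le> emeasure lborel ?J"
      by (intro emeasure_mono) auto
    also have "\<dots> < \<infinity>" by (simp add: emeasure_bounded_finite[simplified])
    finally show ?thesis .
  qed
  have J: "sq_integrable (indicator ?J)"
    by (intro sq_integrable_indicator) (simp_all add: emeasure_bounded_finite[simplified])
  have Int: "Int_stable (range (lessThan :: real \<Rightarrow> real set))"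
  proof (rule Int_stableI)
    fix A B :: "real set" assume "A \<in> range lessThan" "B \<in> range (lessThan :: real \<Rightarrow> real set)"
    then obtain x y where "A = {..<x}" "B = {..<y}" by auto
    then have "A \<inter> B = {..<min x y}" by auto
    then show "A \<inter> B \<in> range lessThan" by simp
  qed
  have "A \<in> sigma_sets UNIV (range lessThan)"
    using assms by (subst (asm) borel_Iio) simp
  note A = this
  have sub: "range (lessThan :: real \<Rightarrow> real set) \<subseteq> Pow UNIV" by simp
  from Int sub A show ?thesis
  proof (induction rule: sigma_sets_induct_disjoint)
    case (basic A)
    then obtain x where "A = {..<x}" by auto
    then have "A \<inter> ?J = {a..<min x b}" by auto
    then show ?case by (simp add: elementary_step_approximable elementary_indicator)
  next
    case empty
    have "step_approximable (indicator {0..<0})"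
      by (intro elementary_step_approximable elementary_indicator)
    also have "{0..<0} = {} \<inter> ?J" by simp
    finally show ?case .
  next
    case (compl A)
    have "step_approximable (\<lambda>x. indicator ?J x + (-1) * indicator (A \<inter> ?J) x)"
      by (intro step_approximable_add step_approximable_scale compl
          elementary_step_approximable elementary_indicator)
    also have "(\<lambda>x. indicator ?J x + (-1) * indicator (A \<inter> ?J) x) = (indicator ((UNIV - A) \<inter> ?J) :: real \<Rightarrow> real)"
      by (auto simp: indicator_def fun_eq_iff)
    finally show ?case .
  next
    case (union A)
    have A: "A i \<in> sets borel" for i
      using union(2) by (subst borel_Iio) auto
    define U :: "nat \<Rightarrow> real \<Rightarrow> real" where "U n x = (\<Sum>i<n. indicator (A i \<inter> ?J) x)" for n x
    have U: "step_approximable (U n)" for n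
    proof (induction n)
      case 0
      have "U 0 = indicator {0..<0}" by (auto simp: U_def)
      then show ?case by (simp only: elementary_step_approximable elementary_indicator)
    next
      case (Suc n)
      have "U (Suc n) = (\<lambda>x. U n x + indicator (A n \<inter> ?J) x)" by (auto simp: U_def)
      then show ?case using Suc union(3) by (simp add: step_approximable_add)
    qed
    have U_eq: "U n = indicator (\<Union>i<n. A i \<inter> ?J)" for n
    proof
      fix x
      have "disjoint_family_on (\<lambda>i. A i \<inter> ?J) {..<n}"
        using union(1) by (auto simp: disjoint_family_on_def)
      then show "U n x = indicator (\<Union>i<n. A i \<inter> ?J) x"
        unfolding U_def by (subst indicator_UN_disjoint) auto
    qed
    have lim: "(\<lambda>n. U n x) \<longlonglongrightarrow> indicator (\<Union> (range A) \<inter> ?J) x" for x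
    proof (cases "x \<in> \<Union> (range A) \<inter> ?J")
      case True
      then obtain i where i: "x \<in> A i \<inter> ?J" by auto
      have "\<forall>\<^sub>F n in sequentially. U n x = 1"
        using eventually_gt_at_top[of i] by eventually_elim (use i in \<open>auto simp: U_eq indicator_def\<close>)
      then show ?thesis using True by (simp add: tendsto_eventually)
    next
      case False
      then have "U n x = 0" for n by (auto simp: U_eq indicator_def)
      then show ?thesis using False by simp
    qed
    have UA: "\<Union> (range A) \<in> sets borel" using A by auto
    have sq: "sq_integrable (indicator (\<Union> (range A) \<inter> ?J))"
      using fin UA by (intro sq_integrable_indicator) auto
    have [measurable]: "U n \<in> borel_measurable borel" for n
      using U[of n] by (auto simp: step_approximable_def sq_integrable_def)
    show ?case
    proof (rule step_approximable_limit[OF sq U square_dist_tendsto_0[where U = U, OF J]])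
      show "AE x in lborel. \<bar>indicator (\<Union> (range A) \<inter> ?J) x - U n x\<bar> \<le> \<bar>indicator ?J x\<bar>" for n
        by (rule AE_I2) (auto simp: U_eq indicator_def)
    qed (use sq lim in \<open>auto simp: sq_integrable_def\<close>)
  qed
qed

text \<open>
  Sets of finite measure are limits of bounded sets; then the standard induction for nonnegative
  functions applies: in sums and monotone limits the smaller functions inherit square integrability from
  the larger one, which is also a majorant for the limit.
\<close>

lemma step_approximable_nonneg:
  assumes "f \<in> borel_measurable borel" "\<And>x. 0 \<le> f x" "sq_integrable f"
  shows "step_approximable f"
  using assms
proof (induction f rule: borel_measurable_induct_real)
  case (set A)
  define U :: "nat \<Rightarrow> real \<Rightarrow> real" where "U n = indicator (A \<inter> {- real n..<real n})" for n
  have [measurable]: "A \<in> sets borel" using set by simp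
  show ?case
  proof (rule step_approximable_limit[OF set(2) _ square_dist_tendsto_0[OF set(2)]])
    show "step_approximable (U n)" for n
      unfolding U_def by (rule step_approximable_bounded_set) simp
    show "U n \<in> borel_measurable borel" for n unfolding U_def by measurable
    show "AE x in lborel. (\<lambda>n. U n x) \<longlonglongrightarrow> indicator A x"
    proof (rule AE_I2)
      fix x :: real
      have "\<forall>\<^sub>F n in sequentially. \<bar>x\<bar> < real n"
        by (metis eventually_at_top_dense filterlim_iff filterlim_real_sequentially)
      then have "\<forall>\<^sub>F n in sequentially. U n x = indicator A x"
        by eventually_elim (auto simp: U_def indicator_def)
      then show "(\<lambda>n. U n x) \<longlonglongrightarrow> indicator A x" by (rule tendsto_eventually)
    qed
  qed (auto simp: U_def indicator_def)
next
  case (mult u c)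
  show ?case
  proof (cases "c = 0")
    case True
    have "(\<lambda>x. c * u x) = indicator {0..<0}" using True by auto
    then show ?thesis by (simp only: elementary_step_approximable elementary_indicator)
  next
    case False
    have "sq_integrable (\<lambda>x. inverse c * (c * u x))" by (rule sq_integrable_scale) (rule mult)
    with False show ?thesis
      by (intro step_approximable_scale mult) (simp add: mult.assoc[symmetric])
  qed
next
  case (add u v)
  then show ?case
    by (intro step_approximable_add add.IH; intro sq_integrable_mono[OF add.prems]) auto
next
  case (seq U)
  have m: "f \<in> borel_measurable borel" using seq.prems by (simp add: sq_integrable_def)
  have le: "U i x \<le> f x" for i x
    using seq.hyps by (intro incseq_le) (auto simp: incseq_def le_fun_def)
  show ?case
  proof (rule step_approximable_limit[OF seq.prems _ square_dist_tendsto_0[where U = U, OF seq.prems]])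
    show "step_approximable (U n)" for n
      using seq le[of n] by (intro seq.IH sq_integrable_mono[OF seq.prems]) (auto simp: intro!: order_trans[OF le abs_ge_self])
    show "AE x in lborel. \<bar>f x - U n x\<bar> \<le> \<bar>f x\<bar>" for n
    proof (rule AE_I2)
      fix x show "\<bar>f x - U n x\<bar> \<le> \<bar>f x\<bar>" using le[of n x] seq.hyps(2)[of n x] by linarith
    qed
  qed (use seq m in auto)
qed

lemma sq_integrable_imp_step_approximable:
  assumes f: "sq_integrable f"
  shows "step_approximable f"
proof -
  note [measurable] = sq_integrable_measurable[OF f]
  have "step_approximable (\<lambda>x. max 0 (f x))" "step_approximable (\<lambda>x. max 0 (- f x))"
    by (intro step_approximable_nonneg sq_integrable_mono[OF f]; force)+
  then have "step_approximable (\<lambda>x. max 0 (f x) + (-1) * max 0 (- f x))"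
    by (intro step_approximable_add step_approximable_scale)
  also have "(\<lambda>x. max 0 (f x) + (-1) * max 0 (- f x)) = f" by auto
  finally show ?thesis .
qed


section \<open>Correlation with an integrable kernel\<close>

text \<open>
  The cross-correlation of \<open>f\<close> with \<open>k\<close>, that is, the convolution of \<open>f\<close> with the reflection of \<open>k\<close>.
  For the tempered power kernel it is \<open>Gamma(\<alpha>)\<close> times the negative tempered fractional integral.
\<close>

definition corr :: "(real \<Rightarrow> real) \<Rightarrow> (real \<Rightarrow> real) \<Rightarrow> real \<Rightarrow> real" where
  "corr k f t = (LINT u|lborel. f u * k (u - t))"

lemma corr_measurable [measurable]:
  assumes [measurable]: "k \<in> borel_measurable borel" "f \<in> borel_measurable borel"
  shows "corr k f \<in> borel_measurable borel"
  unfolding corr_def[abs_def] by measurable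

lemma nn_integral_shift:
  fixes k :: "real \<Rightarrow> ennreal"
  assumes [measurable]: "k \<in> borel_measurable borel"
  shows "(\<integral>\<^sup>+u. k (u - t) \<partial>lborel) = (\<integral>\<^sup>+x. k x \<partial>lborel)"
    and "(\<integral>\<^sup>+u. k (t - u) \<partial>lborel) = (\<integral>\<^sup>+x. k x \<partial>lborel)"
  using nn_integral_real_affine[of k 1 "-t"] nn_integral_real_affine[of k "-1" t]
  by (simp_all add: algebra_simps)

text \<open>
  Young's inequality \<open>L\<^sup>1 * L\<^sup>2 \<subseteq> L\<^sup>2\<close>, for the kernel \<open>k\<^sup>2\<close>. Writing the kernel as a square lets
  Cauchy--Schwarz split \<open>f k\<^sup>2\<close> into \<open>f k\<close> and \<open>k\<close> without square roots in the extended reals; Tonelli and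
  translation invariance then evaluate what is left.
\<close>

lemma nn_integral_Young:
  fixes f k :: "real \<Rightarrow> ennreal"
  assumes [measurable]: "f \<in> borel_measurable borel" "k \<in> borel_measurable borel"
  shows "(\<integral>\<^sup>+t. (\<integral>\<^sup>+u. f u * (k (u - t))\<^sup>2 \<partial>lborel)\<^sup>2 \<partial>lborel)
    \<le> (\<integral>\<^sup>+x. (k x)\<^sup>2 \<partial>lborel)\<^sup>2 * (\<integral>\<^sup>+x. (f x)\<^sup>2 \<partial>lborel)"
proof -
  let ?K = "\<integral>\<^sup>+x. (k x)\<^sup>2 \<partial>lborel"
  have "(\<integral>\<^sup>+u. f u * (k (u - t))\<^sup>2 \<partial>lborel)\<^sup>2 \<le> ?K * (\<integral>\<^sup>+u. (f u)\<^sup>2 * (k (u - t))\<^sup>2 \<partial>lborel)" for t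
  proof -
    have "(\<integral>\<^sup>+u. f u * (k (u - t))\<^sup>2 \<partial>lborel)\<^sup>2 = (\<integral>\<^sup>+u. (f u * k (u - t)) * k (u - t) \<partial>lborel)\<^sup>2"
      by (simp add: power2_eq_square mult.assoc)
    also have "\<dots> \<le> (\<integral>\<^sup>+u. (f u * k (u - t))\<^sup>2 \<partial>lborel) * (\<integral>\<^sup>+u. (k (u - t))\<^sup>2 \<partial>lborel)"
      by (rule Cauchy_Schwarz_nn_integral) measurable
    also have "(\<integral>\<^sup>+u. (k (u - t))\<^sup>2 \<partial>lborel) = ?K"
      by (rule nn_integral_shift(1)) measurable
    finally show ?thesis by (simp add: power_mult_distrib mult.commute)
  qed
  then have "(\<integral>\<^sup>+t. (\<integral>\<^sup>+u. f u * (k (u - t))\<^sup>2 \<partial>lborel)\<^sup>2 \<partial>lborel)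
      \<le> (\<integral>\<^sup>+t. ?K * (\<integral>\<^sup>+u. (f u)\<^sup>2 * (k (u - t))\<^sup>2 \<partial>lborel) \<partial>lborel)"
    by (intro nn_integral_mono)
  also have "\<dots> = ?K * (\<integral>\<^sup>+t. \<integral>\<^sup>+u. (f u)\<^sup>2 * (k (u - t))\<^sup>2 \<partial>lborel \<partial>lborel)"
    by (rule nn_integral_cmult) measurable
  also have "(\<integral>\<^sup>+t. \<integral>\<^sup>+u. (f u)\<^sup>2 * (k (u - t))\<^sup>2 \<partial>lborel \<partial>lborel)
      = (\<integral>\<^sup>+u. \<integral>\<^sup>+t. (f u)\<^sup>2 * (k (u - t))\<^sup>2 \<partial>lborel \<partial>lborel)"
    by (rule lborel_pair.Fubini') measurable
  also have "\<dots> = (\<integral>\<^sup>+u. (f u)\<^sup>2 * ?K \<partial>lborel)"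
    by (simp add: nn_integral_cmult nn_integral_shift(2)[where k = "\<lambda>x. (k x)\<^sup>2"])
  also have "\<dots> = (\<integral>\<^sup>+u. (f u)\<^sup>2 \<partial>lborel) * ?K"
    by (rule nn_integral_multc) measurable
  finally show ?thesis by (simp add: power2_eq_square mult_ac)
qed

text \<open>
  Young's inequality for real functions. The defining integral of \<open>corr k f\<close> need not converge at every
  point, since \<open>k\<close> need not be square integrable; it does so almost everywhere because the correlation of
  the absolute values has finite \<open>L\<^sup>2\<close> norm. Linearity in \<open>f\<close> therefore holds only almost everywhere.
\<close>

lemma
  assumes f: "sq_integrable f" and k: "integrable lborel k" "\<And>x. 0 \<le> k x"
  shows AE_integrable_corr: "AE t in lborel. integrable lborel (\<lambda>u. f u * k (u - t))"
    and sq_integrable_corr: "sq_integrable (corr k f)"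
    and integral_corr_square_le:
      "(LINT t|lborel. (corr k f t)\<^sup>2) \<le> (LINT x|lborel. k x)\<^sup>2 * (LINT x|lborel. (f x)\<^sup>2)"
proof -
  have [measurable]: "f \<in> borel_measurable borel" "k \<in> borel_measurable borel"
    using sq_integrable_measurable[OF f] k(1)[THEN borel_measurable_integrable] by simp_all
  define N where "N t = (\<integral>\<^sup>+u. ennreal \<bar>f u * k (u - t)\<bar> \<partial>lborel)" for t
  have [measurable]: "N \<in> borel_measurable borel" unfolding N_def[abs_def] by measurable
  have N: "N t = (\<integral>\<^sup>+u. ennreal \<bar>f u\<bar> * (ennreal (sqrt (k (u - t))))\<^sup>2 \<partial>lborel)" for t
    unfolding N_def by (intro nn_integral_cong)
      (simp add: abs_mult k(2) ennreal_mult ennreal_power)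
  have kx: "(\<integral>\<^sup>+x. (ennreal (sqrt (k x)))\<^sup>2 \<partial>lborel) = ennreal (LINT x|lborel. k x)"
    using k by (simp add: ennreal_power nn_integral_eq_integral)
  have fx: "(\<integral>\<^sup>+x. (ennreal \<bar>f x\<bar>)\<^sup>2 \<partial>lborel) = ennreal (LINT x|lborel. (f x)\<^sup>2)"
    using f by (simp add: ennreal_power nn_integral_eq_integral sq_integrable_def)
  have "(\<integral>\<^sup>+t. (N t)\<^sup>2 \<partial>lborel)
      \<le> (ennreal (LINT x|lborel. k x))\<^sup>2 * ennreal (LINT x|lborel. (f x)\<^sup>2)"
    unfolding N kx[symmetric] fx[symmetric] by (rule nn_integral_Young) measurable
  also have "\<dots> = ennreal ((LINT x|lborel. k x)\<^sup>2 * (LINT x|lborel. (f x)\<^sup>2))"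
    using k by (simp add: ennreal_mult ennreal_power)
  finally have bound: "(\<integral>\<^sup>+t. (N t)\<^sup>2 \<partial>lborel) \<le> ennreal ((LINT x|lborel. k x)\<^sup>2 * (LINT x|lborel. (f x)\<^sup>2))" .
  have "AE t in lborel. (N t)\<^sup>2 \<noteq> \<infinity>"
    by (rule nn_integral_PInf_AE) (use bound in \<open>auto simp: top_unique\<close>)
  then have fin: "AE t in lborel. N t < \<infinity>"
    by eventually_elim (auto simp: less_top[symmetric])
  then show "AE t in lborel. integrable lborel (\<lambda>u. f u * k (u - t))"
  proof eventually_elim
    case (elim t)
    then show ?case by (intro integrableI_bounded) (auto simp: N_def)
  qed
  have "ennreal \<bar>corr k f t\<bar> \<le> N t" for t
    unfolding N_def corr_def using integral_norm_bound_ennreal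
      [of lborel "\<lambda>u. f u * k (u - t)"]
    by (cases "integrable lborel (\<lambda>u. f u * k (u - t))") (auto simp: not_integrable_integral_eq)
  then have "(ennreal \<bar>corr k f t\<bar>)\<^sup>2 \<le> (N t)\<^sup>2" for t
    by (intro power_mono) auto
  then have "(\<integral>\<^sup>+t. (ennreal \<bar>corr k f t\<bar>)\<^sup>2 \<partial>lborel) \<le> (\<integral>\<^sup>+t. (N t)\<^sup>2 \<partial>lborel)"
    by (intro nn_integral_mono)
  then have le: "(\<integral>\<^sup>+t. ennreal ((corr k f t)\<^sup>2) \<partial>lborel)
      \<le> ennreal ((LINT x|lborel. k x)\<^sup>2 * (LINT x|lborel. (f x)\<^sup>2))"
    using bound by (simp add: ennreal_power)
  show "sq_integrable (corr k f)"
    unfolding sq_integrable_def using le by (auto intro!: integrableI_nonneg simp: le_less_trans)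
  then have "ennreal (LINT t|lborel. (corr k f t)\<^sup>2)
      \<le> ennreal ((LINT x|lborel. k x)\<^sup>2 * (LINT x|lborel. (f x)\<^sup>2))"
    using le by (subst nn_integral_eq_integral[symmetric]) (auto simp: sq_integrable_def)
  then show "(LINT t|lborel. (corr k f t)\<^sup>2) \<le> (LINT x|lborel. k x)\<^sup>2 * (LINT x|lborel. (f x)\<^sup>2)"
    by (subst (asm) ennreal_le_iff) auto
qed

lemma AE_corr_add:
  assumes "AE t in lborel. integrable lborel (\<lambda>u. f u * k (u - t))"
    and "AE t in lborel. integrable lborel (\<lambda>u. g u * k (u - t))"
  shows "AE t in lborel. corr k (\<lambda>u. f u + g u) t = corr k f t + corr k g t"
  using assms by eventually_elim (simp add: corr_def distrib_right)

lemma corr_scale: "corr k (\<lambda>u. c * f u) t = c * corr k f t"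
  by (simp add: corr_def mult.assoc)

lemma AE_corr_diff:
  assumes "AE t in lborel. integrable lborel (\<lambda>u. f u * k (u - t))"
    and "AE t in lborel. integrable lborel (\<lambda>u. g u * k (u - t))"
  shows "AE t in lborel. corr k (\<lambda>u. f u - g u) t = corr k f t - corr k g t"
  using assms by eventually_elim (simp add: corr_def left_diff_distrib)

section \<open>Tempered power kernels\<close>

definition tempered_kernel :: "real \<Rightarrow> real \<Rightarrow> real \<Rightarrow> real" where
  "tempered_kernel lam a s = pos_part s powr (a - 1) * exp (- lam * pos_part s)"

lemma tempered_kernel_pos: "0 < s \<Longrightarrow> tempered_kernel lam a s = s powr (a - 1) * exp (- lam * s)"
  and tempered_kernel_nonpos: "s \<le> 0 \<Longrightarrow> tempered_kernel lam a s = 0"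
  by (simp_all add: tempered_kernel_def pos_part_def)

lemma tempered_kernel_nonneg: "0 \<le> tempered_kernel lam a s"
  by (simp add: tempered_kernel_def)

lemma tempered_kernel_measurable [measurable]: "tempered_kernel lam a \<in> borel_measurable borel"
  unfolding tempered_kernel_def[abs_def] by measurable

lemma tempered_kernel_one:
  "tempered_kernel lam 1 (u - t) = exp (lam * t) * (indicator {t<..} u * exp (- lam * u))"
  by (cases "t < u")
    (simp_all add: tempered_kernel_pos tempered_kernel_nonpos exp_add[symmetric] algebra_simps)

lemma tempered_kernel_square: "(tempered_kernel lam a s)\<^sup>2 = tempered_kernel (2 * lam) (2 * a - 1) s"
proof (cases "0 < s")
  case True
  have "(s powr (a - 1))\<^sup>2 = s powr (2 * a - 1 - 1)"
    by (simp add: power2_eq_square powr_add[symmetric])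
  moreover have "(exp (- lam * s))\<^sup>2 = exp (- (2 * lam) * s)"
    by (simp add: power2_eq_square exp_add[symmetric])
  ultimately show ?thesis using True by (simp only: tempered_kernel_pos power_mult_distrib)
qed (simp add: tempered_kernel_nonpos)

text \<open>
  A rescaling by \<open>lam\<close> turns the integral into the Gamma integral.
\<close>

lemma integrable_tempered_kernel:
  assumes "0 < lam" "0 < a"
  shows "integrable lborel (tempered_kernel lam a)"
proof -
  define h where "h t = indicator {0..} t * t powr (a - 1) / exp t" for t :: real
  have "integrable lborel h"
    using Gamma_conv_nn_integral_real[OF assms(2)]
    by (intro integrableI_nonneg) (auto simp: h_def[abs_def] less_top[symmetric])
  then have "integrable lborel (\<lambda>s. lam powr (1 - a) * h (0 + lam * s))"
    using assms by (intro integrable_mult_right lborel_integrable_real_affine) auto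
  moreover have "lam powr (1 - a) * h (0 + lam * s) = tempered_kernel lam a s" for s
  proof (cases "0 < s")
    case True
    have "lam powr (1 - a) * lam powr (a - 1) = 1"
      using assms by (simp add: powr_add[symmetric])
    with True assms show ?thesis
      by (simp add: h_def tempered_kernel_pos powr_mult exp_minus field_simps)
  next
    case False
    then show ?thesis using assms
      by (auto simp: h_def tempered_kernel_nonpos indicator_def zero_le_mult_iff)
  qed
  ultimately show ?thesis by (simp only:)
qed

text \<open>
  The semigroup law: \<open>k\<^sub>a * k\<^sub>b = Beta(a, b) k\<^sub>a\<^sub>+\<^sub>b\<close>. The exponential factors multiply to one that is
  free of the integration variable, and the substitution \<open>v = t + (u - t) x\<close> reduces the powers to
  the Beta integral.
\<close>

lemma nn_integral_tempered_kernel_convolution: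
  assumes "0 < a" "0 < b"
  shows "(\<integral>\<^sup>+v. ennreal (tempered_kernel lam a (u - v) * tempered_kernel lam b (v - t)) \<partial>lborel)
    = ennreal (Beta a b * tempered_kernel lam (a + b) (u - t))"
proof (cases "t < u")
  case False
  have "tempered_kernel lam a (u - v) * tempered_kernel lam b (v - t) = 0" for v
    using False by (cases "v < u") (simp_all add: tempered_kernel_nonpos)
  then show ?thesis using False by (simp only: tempered_kernel_nonpos) simp
next
  case True
  define d where "d = u - t"
  have d: "0 < d" using True by (simp add: d_def)
  define c where "c = d powr (a + b - 2) * exp (- lam * d)"
  have eq: "tempered_kernel lam a (u - (t + d * x)) * tempered_kernel lam b (t + d * x - t)
      = c * (indicator {0..1} x * (x powr (b - 1) * (1 - x) powr (a - 1)))" for x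
  proof (cases "0 < x \<and> x < 1")
    case True
    have ux: "u - (t + d * x) = d * (1 - x)" "t + d * x - t = d * x"
      by (simp_all add: d_def algebra_simps)
    have p: "0 < d * (1 - x)" "0 < d * x" using True d by simp_all
    have "d powr (a - 1) * d powr (b - 1) = d powr (a + b - 2)"
      by (simp add: powr_add[symmetric])
    moreover have "exp (- lam * (d * (1 - x))) * exp (- lam * (d * x)) = exp (- lam * d)"
      by (simp add: exp_add[symmetric] algebra_simps)
    ultimately have "c = (d powr (a - 1) * d powr (b - 1)) * (exp (- lam * (d * (1 - x))) * exp (- lam * (d * x)))"
      by (simp only: c_def)
    then show ?thesis using True d p
      unfolding ux tempered_kernel_pos[OF p(1)] tempered_kernel_pos[OF p(2)]
      by (simp add: powr_mult)
  next
    case False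
    have "u - (t + d * x) = d * (1 - x)" "t + d * x - t = d * x"
      by (simp_all add: d_def algebra_simps)
    moreover have "d * (1 - x) \<le> 0 \<or> d * x \<le> 0"
      using False d by (auto simp: mult_le_0_iff)
    moreover have "indicator {0..1} x * (x powr (b - 1) * (1 - x) powr (a - 1)) = (0::real)"
      using False by (cases "x = 0 \<or> x = 1") (auto simp: indicator_def)
    ultimately show ?thesis by (auto simp: tempered_kernel_nonpos)
  qed
  have c: "0 \<le> c" by (simp add: c_def)
  have "(\<integral>\<^sup>+v. ennreal (tempered_kernel lam a (u - v) * tempered_kernel lam b (v - t)) \<partial>lborel)
      = ennreal d * (\<integral>\<^sup>+x. ennreal (tempered_kernel lam a (u - (t + d * x)) * tempered_kernel lam b (t + d * x - t)) \<partial>lborel)"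
    using d by (subst nn_integral_real_affine[where c = d and t = t]) auto
  also have "\<dots> = ennreal d * (\<integral>\<^sup>+x. ennreal c * ennreal (indicator {0..1} x * (x powr (b - 1) * (1 - x) powr (a - 1))) \<partial>lborel)"
    unfolding eq using c by (simp add: ennreal_mult')
  also have "\<dots> = ennreal d * (ennreal c * (\<integral>\<^sup>+x. ennreal (indicator {0..1} x * (x powr (b - 1) * (1 - x) powr (a - 1))) \<partial>lborel))"
    by (subst nn_integral_cmult) auto
  also have "(\<integral>\<^sup>+x. ennreal (indicator {0..1} x * (x powr (b - 1) * (1 - x) powr (a - 1))) \<partial>lborel) = ennreal (Beta b a)"
    by (rule nn_integral_has_integral_lebesgue[OF _ has_integral_Beta_real]) (use assms in auto)
  also have "ennreal d * (ennreal c * ennreal (Beta b a)) = ennreal (Beta a b * (d * c))"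
    using d c by (simp add: ennreal_mult'[symmetric] Beta_commute mult_ac)
  also have "d * c = tempered_kernel lam (a + b) d"
  proof -
    have "d powr 1 * d powr (a + b - 2) = d powr (a + b - 1)"
      unfolding powr_add[symmetric] by (simp add: algebra_simps)
    then show ?thesis using d unfolding c_def tempered_kernel_pos[OF d] by (simp add: mult.assoc[symmetric])
  qed
  finally show ?thesis by (simp add: d_def)
qed

lemma Beta_pos_real: "0 < a \<Longrightarrow> 0 < b \<Longrightarrow> 0 < Beta a (b :: real)"
  by (simp add: Beta_def Gamma_real_pos)

lemma
  assumes "0 < a" "0 < b"
  shows integrable_tempered_kernel_convolution:
      "integrable lborel (\<lambda>v. tempered_kernel lam a (u - v) * tempered_kernel lam b (v - t))" (is ?i)
    and integral_tempered_kernel_convolution: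
      "(LINT v|lborel. tempered_kernel lam a (u - v) * tempered_kernel lam b (v - t))
        = Beta a b * tempered_kernel lam (a + b) (u - t)" (is ?e)
proof -
  note eq = nn_integral_tempered_kernel_convolution[OF assms, of lam u t]
  show ?i
    by (rule integrableI_nonneg) (auto simp: eq tempered_kernel_nonneg)
  show ?e
    by (subst integral_eq_nn_integral)
      (auto simp: eq tempered_kernel_nonneg Beta_pos_real[OF assms] less_imp_le)
qed


section \<open>Injectivity\<close>

text \<open>
  The half lines form an intersection-stable generator of the Borel sets, so a function with vanishing
  integrals over them has vanishing integral over every Borel set.
\<close>

lemma AE_zero_if_tail_integrals_zero:
  fixes g :: "real \<Rightarrow> real"
  assumes g: "integrable lborel g"
    and tail: "\<And>t. (LINT u|lborel. indicator {t<..} u * g u) = 0"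
    and total: "(LINT u|lborel. g u) = 0"
  shows "AE u in lborel. g u = 0"
proof (rule sigma_finite_measure.density_zero[OF lborel.sigma_finite_measure_axioms g])
  fix A :: "real set" assume A: "A \<in> sets lborel"
  have si: "set_integrable lborel B g" if "B \<in> sets borel" for B
    using g that unfolding set_integrable_def by (intro integrable_mult_indicator) auto
  have Int: "Int_stable (range (greaterThan :: real \<Rightarrow> real set))"
  proof (rule Int_stableI)
    fix A B :: "real set" assume "A \<in> range greaterThan" "B \<in> range greaterThan"
    then obtain x y where "A = {x<..}" "B = {y<..}" by auto
    then have "A \<inter> B = {max x y<..}" by auto
    then show "A \<inter> B \<in> range greaterThan" by simp
  qed
  have "A \<in> sets borel" using A by simp
  then have A: "A \<in> sigma_sets UNIV (range greaterThan)"
    by (subst (asm) borel_Ioi) simp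
  have sub: "range (greaterThan :: real \<Rightarrow> real set) \<subseteq> Pow UNIV" by simp
  from Int sub A show "set_lebesgue_integral lborel A g = 0"
  proof (induction rule: sigma_sets_induct_disjoint)
    case (basic A)
    then show ?case using tail by (auto simp: set_lebesgue_integral_def)
  next
    case empty
    show ?case by (simp add: set_lebesgue_integral_def)
  next
    case (compl A)
    have A: "A \<in> sets borel" using compl(1) by (subst borel_Ioi) simp
    have "set_lebesgue_integral lborel (UNIV - A) g
        = (LINT u|lborel. g u - indicator A u *\<^sub>R g u)"
      unfolding set_lebesgue_integral_def
      by (rule Bochner_Integration.integral_cong) (auto simp: indicator_def)
    also have "\<dots> = (LINT u|lborel. g u) - set_lebesgue_integral lborel A g"
      unfolding set_lebesgue_integral_def using g si[OF A]
      by (intro Bochner_Integration.integral_diff) (auto simp: set_integrable_def)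
    finally show ?case by (simp add: total compl.IH)
  next
    case (union A)
    have A: "A i \<in> sets borel" for i
      using union(2) by (subst borel_Ioi) auto
    have "set_lebesgue_integral lborel (\<Union> (range A)) g = (\<Sum>i. set_lebesgue_integral lborel (A i) g)"
      using A union(1) by (intro lebesgue_integral_countable_add si)
        (auto simp: disjoint_family_on_def)
    then show ?case by (simp add: union.IH)
  qed
qed

lemma AE_zero_if_local_tail_integrals_zero:
  fixes h :: "real \<Rightarrow> real"
  assumes h: "\<And>t. integrable lborel (\<lambda>u. indicator {t<..} u * h u)"
    and tail: "\<And>t. (LINT u|lborel. indicator {t<..} u * h u) = 0"
  shows "AE u in lborel. h u = 0"
proof -
  have "AE u in lborel. indicator {- real n<..} u * h u = 0" for n
  proof (rule AE_zero_if_tail_integrals_zero[OF h _ tail])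
    fix t
    have "(LINT u|lborel. indicator {t<..} u * (indicator {- real n<..} u * h u))
        = (LINT u|lborel. indicator {max t (- real n)<..} u * h u)"
      by (rule Bochner_Integration.integral_cong) (auto simp: indicator_def)
    then show "(LINT u|lborel. indicator {t<..} u * (indicator {- real n<..} u * h u)) = 0"
      by (simp add: tail)
  qed
  then have "AE u in lborel. \<forall>n. indicator {- real n<..} u * h u = 0"
    by (subst AE_all_countable) (rule allI)
  then show ?thesis
  proof eventually_elim
    case (elim u)
    obtain n where "- u < real n" using reals_Archimedean2 by blast
    then show ?case using elim[rule_format, of n] by (simp add: indicator_def)
  qed
qed

text \<open>
  Fractional integration is inverted up to one ordinary integration: correlating \<open>k\<^sub>a * f\<close> with
  \<open>k\<^sub>1\<^sub>-\<^sub>a\<close> yields, by Fubini and the semigroup law, a positive multiple of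
  \<open>\<integral>\<^sub>t\<^sup>\<infinity> f(u) exp(- lam (u - t)) du\<close>. If the correlation vanishes, then so do these
  integrals for every \<open>t\<close>, which determines \<open>f\<close>. The integrability hypothesis is exactly what Fubini
  needs; for \<open>lam > 0\<close> it covers the functions in \<open>L\<^sup>2\<close> and also integrable power singularities outside \<open>L\<^sup>2\<close>.
\<close>

lemma corr_tempered_kernel_injective:
  assumes a: "0 < a" "a < 1" and [measurable]: "f \<in> borel_measurable borel"
    and f: "\<And>t. integrable lborel (\<lambda>u. f u * tempered_kernel lam 1 (u - t))"
    and zero: "AE t in lborel. corr (tempered_kernel lam a) f t = 0"
  shows "AE u in lborel. f u = 0"
proof -
  let ?k = "tempered_kernel lam"
  have ab: "0 < a" "0 < 1 - a" using a by auto
  define B where "B = Beta a (1 - a)"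
  have B: "0 < B" unfolding B_def using ab by (rule Beta_pos_real)
  have conv: "(LINT u|lborel. f u * ?k 1 (u - t)) = 0" for t
  proof -
    define \<Phi> where "\<Phi> v u = f u * ?k a (u - v) * ?k (1 - a) (v - t)" for v u
    have [measurable]: "(\<lambda>(u, v). \<Phi> v u) \<in> borel_measurable (borel \<Otimes>\<^sub>M borel)"
      unfolding \<Phi>_def by measurable
    have split: "\<Phi> v u = f u * (?k a (u - v) * ?k (1 - a) (v - t))" for u v
      by (simp add: \<Phi>_def mult.assoc)
    have int: "integrable (lborel \<Otimes>\<^sub>M lborel) (\<lambda>(u, v). \<Phi> v u)"
    proof (rule lborel_pair.Fubini_integrable)
      show "(\<lambda>(u, v). \<Phi> v u) \<in> borel_measurable (lborel \<Otimes>\<^sub>M lborel)" by measurable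
      show "AE u in lborel. integrable lborel (\<lambda>v. case (u, v) of (u, v) \<Rightarrow> \<Phi> v u)"
        unfolding split prod.case
        by (intro AE_I2 integrable_mult_right integrable_tempered_kernel_convolution ab)
      have "(LINT v|lborel. norm (\<Phi> v u)) = B * norm (f u * ?k 1 (u - t))" for u
        using integral_tempered_kernel_convolution[OF ab, of lam u t]
        unfolding split by (simp add: abs_mult tempered_kernel_nonneg B_def)
      then show "integrable lborel (\<lambda>u. LINT v|lborel. norm (case (u, v) of (u, v) \<Rightarrow> \<Phi> v u))"
        using f[of t] by simp
    qed
    have "0 = (LINT v|lborel. corr (?k a) f v * ?k (1 - a) (v - t))"
      using zero by (intro integral_eq_zero_AE[symmetric]) (auto elim: eventually_mono)
    also have "\<dots> = (LINT v|lborel. LINT u|lborel. \<Phi> v u)"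
      by (simp add: corr_def \<Phi>_def)
    also have "\<dots> = (LINT u|lborel. LINT v|lborel. \<Phi> v u)"
      using int by (rule lborel_pair.Fubini_integral)
    also have "\<dots> = (LINT u|lborel. B * (f u * ?k 1 (u - t)))"
      unfolding split
      by (simp add: integral_tempered_kernel_convolution[OF ab] B_def mult_ac)
    also have "\<dots> = B * (LINT u|lborel. f u * ?k 1 (u - t))" by simp
    finally show ?thesis using B by simp
  qed
  have eq: "indicator {t<..} u * (exp (- lam * u) * f u) = exp (- lam * t) * (f u * ?k 1 (u - t))" for t u
  proof -
    have "exp (- lam * t) * exp (lam * t) = 1" by (simp add: exp_add[symmetric])
    then show ?thesis by (simp only: tempered_kernel_one) algebra
  qed
  have "AE u in lborel. exp (- lam * u) * f u = 0"
    by (rule AE_zero_if_local_tail_integrals_zero; unfold eq) (simp_all add: f conv)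
  then show ?thesis by simp
qed

section \<open>A limit outside the range\<close>

lemma sq_integrable_tempered_kernel:
  assumes "0 < lam" "1/2 < b"
  shows "sq_integrable (tempered_kernel lam b)"
  using assms unfolding sq_integrable_def tempered_kernel_square
  by (auto intro!: integrable_tempered_kernel)

lemma sq_integrable_reflect:
  assumes "sq_integrable f" shows "sq_integrable (\<lambda>x. f (t - x))"
proof -
  have [measurable]: "f \<in> borel_measurable borel" by (rule sq_integrable_measurable[OF assms])
  have "integrable lborel (\<lambda>x. (f (t + (-1) * x))\<^sup>2)"
    using assms by (intro lborel_integrable_real_affine[where f = "\<lambda>x. (f x)\<^sup>2"])
      (auto simp: sq_integrable_def)
  then show ?thesis by (simp add: sq_integrable_def)
qed

text \<open>
  The square of the kernel behaves like \<open>1/s\<close> at 0, which has a divergent integral: over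
  \<open>[exp(-n), 1]\<close> it is \<open>n\<close>.
\<close>

lemma not_sq_integrable_tempered_kernel_half: 
  assumes "0 < lam"
  shows "\<not> sq_integrable (tempered_kernel lam (1/2))"
proof
  let ?k = "tempered_kernel (2 * lam) 0"
  assume "sq_integrable (tempered_kernel lam (1/2))"
  then have i: "integrable lborel ?k" by (simp add: sq_integrable_def tempered_kernel_square)
  have "exp (- (2 * lam)) * real n \<le> (LINT s|lborel. ?k s)" for n
  proof -
    define \<epsilon> where "\<epsilon> = exp (- real n)"
    have e: "0 < \<epsilon>" "\<epsilon> \<le> 1" by (simp_all add: \<epsilon>_def)
    have F: "(\<integral>\<^sup>+s. ennreal (1 / s) * indicator {\<epsilon>..1} s \<partial>lborel) = ennreal (ln 1 - ln \<epsilon>)"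
      using e by (intro nn_integral_FTC_Icc) (auto intro!: derivative_eq_intros simp: field_simps)
    have "ennreal (exp (- (2 * lam)) * real n) = ennreal (exp (- (2 * lam))) * ennreal (ln 1 - ln \<epsilon>)"
      by (simp add: \<epsilon>_def ennreal_mult)
    also have "\<dots> = (\<integral>\<^sup>+s. ennreal (exp (- (2 * lam))) * (ennreal (1 / s) * indicator {\<epsilon>..1} s) \<partial>lborel)"
      unfolding F[symmetric] by (rule nn_integral_cmult[symmetric]) measurable
    also have "\<dots> \<le> (\<integral>\<^sup>+s. ennreal (?k s) \<partial>lborel)"
    proof (rule nn_integral_mono)
      fix s :: real
      show "ennreal (exp (- (2 * lam))) * (ennreal (1 / s) * indicator {\<epsilon>..1} s) \<le> ennreal (?k s)"
      proof (cases "s \<in> {\<epsilon>..1}")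
        case True
        then have s: "0 < s" "s \<le> 1" using e by auto
        have "exp (- (2 * lam)) \<le> exp (- (2 * lam) * s)"
          using s assms by simp
        moreover have "?k s = 1 / s * exp (- (2 * lam) * s)"
          using s by (simp add: tempered_kernel_pos powr_minus_divide)
        ultimately have "exp (- (2 * lam)) * (1 / s) \<le> ?k s"
          using s by (simp add: divide_right_mono)
        then have "ennreal (exp (- (2 * lam)) * (1 / s)) \<le> ennreal (?k s)" by (rule ennreal_leI)
        moreover have "ennreal (exp (- (2 * lam)) * (1 / s))
            = ennreal (exp (- (2 * lam))) * (ennreal (1 / s) * indicator {\<epsilon>..1} s)"
          using True s by (subst ennreal_mult) simp_all
        ultimately show ?thesis by (simp only:)
      qed simp
    qed
    also have "\<dots> = ennreal (LINT s|lborel. ?k s)"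
      using i by (intro nn_integral_eq_integral) (auto simp: tempered_kernel_nonneg)
    finally show ?thesis
      by (subst (asm) ennreal_le_iff) (auto intro!: integral_nonneg simp: tempered_kernel_nonneg)
  qed
  moreover obtain n where "(LINT s|lborel. ?k s) / exp (- (2 * lam)) < real n"
    using reals_Archimedean2 by blast
  ultimately show False by (simp add: divide_less_eq mult.commute not_less[symmetric])
qed

text \<open>
  The semigroup law with the upper end point fixed at 0. It exhibits explicit functions whose
  correlations are known at every point.
\<close>

lemma corr_reflected_tempered_kernel:
  assumes "0 < a" "0 < b"
  shows "integrable lborel (\<lambda>u. tempered_kernel lam b (- u) * tempered_kernel lam a (u - t))"
    and "corr (tempered_kernel lam a) (\<lambda>u. tempered_kernel lam b (- u)) t
      = Beta b a * tempered_kernel lam (b + a) (- t)"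
  using integrable_tempered_kernel_convolution[OF assms(2,1), of lam 0 t]
    integral_tempered_kernel_convolution[OF assms(2,1), of lam 0 t]
  by (simp_all add: corr_def)

lemma integrable_tempered_kernel_one_if_sq_integrable:
  assumes "0 < lam" "sq_integrable f"
  shows "integrable lborel (\<lambda>u. f u * tempered_kernel lam 1 (u - t))"
proof -
  have "sq_integrable (\<lambda>u. tempered_kernel lam 1 (t - (t - (u - t))))"
    using sq_integrable_reflect[OF sq_integrable_reflect[OF sq_integrable_tempered_kernel[OF assms(1), of 1], of 0], of t]
    by simp
  then show ?thesis using sq_integrable_mult[OF assms(2)] by simp
qed

lemma sq_integrable_truncation:
  assumes f: "integrable lborel f" "\<And>x. 0 \<le> f x"
  shows "sq_integrable (\<lambda>x. min (f x) (real n))"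
  unfolding sq_integrable_def
proof
  have [measurable]: "f \<in> borel_measurable borel" using f(1)[THEN borel_measurable_integrable] by simp
  show "(\<lambda>x. min (f x) (real n)) \<in> borel_measurable borel" by measurable
  show "integrable lborel (\<lambda>x. (min (f x) (real n))\<^sup>2)"
  proof (rule Bochner_Integration.integrable_bound)
    show "integrable lborel (\<lambda>x. real n * f x)" using f(1) by simp
    have "(min (f x) (real n))\<^sup>2 \<le> real n * f x" for x
      unfolding power2_eq_square using f(2)[of x] by (subst mult.commute, intro mult_mono) auto
    then show "AE x in lborel. norm ((min (f x) (real n))\<^sup>2) \<le> norm (real n * f x)"
      using f(2) by (intro AE_I2) simp
  qed measurable
qed

text \<open>
  Truncating \<open>f\<close> from above at height \<open>n\<close> makes it square integrable, while the correlations increase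
  to \<open>corr k f\<close>, which is their majorant. So they converge in \<open>L\<^sup>2\<close> even if \<open>f\<close> itself is not in \<open>L\<^sup>2\<close>.
\<close>

lemma corr_truncations_tendsto:
  assumes f: "integrable lborel f" "\<And>x. 0 \<le> f x"
    and k: "k \<in> borel_measurable borel" "\<And>x. 0 \<le> k x"
    and fk: "\<And>t. integrable lborel (\<lambda>u. f u * k (u - t))"
    and sq: "sq_integrable (corr k f)"
  shows "(\<lambda>n. LINT t|lborel. (corr k f t - corr k (\<lambda>u. min (f u) (real n)) t)\<^sup>2) \<longlonglongrightarrow> 0"
proof (rule square_dist_tendsto_0[OF sq])
  note [measurable] = k(1)
  have [measurable]: "f \<in> borel_measurable borel" using f(1)[THEN borel_measurable_integrable] by simp
  show "corr k f \<in> borel_measurable borel" "corr k (\<lambda>u. min (f u) (real n)) \<in> borel_measurable borel" for n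
    by measurable
  have le: "0 \<le> min (f u) (real n) * k (u - t)" "min (f u) (real n) * k (u - t) \<le> f u * k (u - t)" for u t n
    using f(2) k(2) by (auto intro!: mult_right_mono)
  have int: "integrable lborel (\<lambda>u. min (f u) (real n) * k (u - t))" for n t
    by (rule Bochner_Integration.integrable_bound[OF fk[of t]])
      (use le f(2) k(2) in \<open>auto simp: abs_mult\<close>)
  have c: "0 \<le> corr k (\<lambda>u. min (f u) (real n)) t" "corr k (\<lambda>u. min (f u) (real n)) t \<le> corr k f t" for n t
    unfolding corr_def using le by (auto intro!: integral_nonneg integral_mono int fk)
  have "\<bar>corr k f t - corr k (\<lambda>u. min (f u) (real n)) t\<bar> \<le> \<bar>corr k f t\<bar>" for n t
    using c[where n = n and t = t] by linarith
  then show "AE t in lborel. \<bar>corr k f t - corr k (\<lambda>u. min (f u) (real n)) t\<bar> \<le> \<bar>corr k f t\<bar>" for n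
    by simp
  have "(\<lambda>n. corr k (\<lambda>u. min (f u) (real n)) t) \<longlonglongrightarrow> corr k f t" for t
    unfolding corr_def
  proof (rule integral_dominated_convergence[where w = "\<lambda>u. f u * k (u - t)"])
    show "AE u in lborel. (\<lambda>n. min (f u) (real n) * k (u - t)) \<longlonglongrightarrow> f u * k (u - t)"
    proof (rule AE_I2)
      fix u
      obtain m where m: "f u < real m" using reals_Archimedean2 by blast
      have "\<forall>\<^sub>F n in sequentially. min (f u) (real n) * k (u - t) = f u * k (u - t)"
        using eventually_ge_at_top[of m] by eventually_elim (use m in \<open>auto simp: min_def\<close>)
      then show "(\<lambda>n. min (f u) (real n) * k (u - t)) \<longlonglongrightarrow> f u * k (u - t)" by (rule tendsto_eventually)
    qed
    show "AE u in lborel. norm (min (f u) (real n) * k (u - t)) \<le> f u * k (u - t)" for n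
      by (intro AE_I2) (use le in auto)
  qed (use fk in measurable)
  then show "AE t in lborel. (\<lambda>n. corr k (\<lambda>u. min (f u) (real n)) t) \<longlonglongrightarrow> corr k f t" by simp
qed


section \<open>Function classes and the fractional integral on them\<close>

lemma aefun_cases:
  obtains f where "f \<in> borel_measurable borel" "F = abs_aefun f"
proof
  show "rep_aefun F \<in> borel_measurable borel"
    using Quotient_rep_reflp[OF Quotient_aefun, of F] by (simp add: ae_eq_def)
  show "F = abs_aefun (rep_aefun F)"
    by (rule Quotient_abs_rep[OF Quotient_aefun, symmetric])
qed

lemma ae_eq_refl: "f \<in> borel_measurable borel \<Longrightarrow> ae_eq f f"
  by (simp add: ae_eq_def)

lemma abs_aefun_eq_iff:
  assumes "f \<in> borel_measurable borel" "g \<in> borel_measurable borel"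
  shows "abs_aefun f = abs_aefun g \<longleftrightarrow> (AE x in lborel. f x = g x)"
  using Quotient_rel[OF Quotient_aefun, of f g] assms by (auto simp: ae_eq_def)

lemma abs_aefun_zero: "0 = abs_aefun (\<lambda>_. 0)"
  by (rule zero_aefun.abs_eq)

lemma abs_aefun_add:
  "f \<in> borel_measurable borel \<Longrightarrow> g \<in> borel_measurable borel \<Longrightarrow>
    abs_aefun f + abs_aefun g = abs_aefun (\<lambda>x. f x + g x)"
  by (simp add: plus_aefun.abs_eq ae_eq_refl)

lemma abs_aefun_diff:
  "f \<in> borel_measurable borel \<Longrightarrow> g \<in> borel_measurable borel \<Longrightarrow>
    abs_aefun f - abs_aefun g = abs_aefun (\<lambda>x. f x - g x)"
  by (simp add: minus_aefun.abs_eq ae_eq_refl)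

lemma abs_aefun_scale:
  "f \<in> borel_measurable borel \<Longrightarrow> c *\<^sub>R abs_aefun f = abs_aefun (\<lambda>x. c * f x)"
  by (simp add: scaleR_aefun.abs_eq ae_eq_refl)

lemma abs_aefun_mem_L2_iff:
  assumes "f \<in> borel_measurable borel"
  shows "abs_aefun f \<in> L2 \<longleftrightarrow> sq_integrable f"
  using assms
  by (auto simp: L2_def square_integral.abs_eq ae_eq_refl sq_integrable_def integrable_iff_bounded)

lemma L2_cases:
  assumes "F \<in> L2"
  obtains f where "sq_integrable f" "F = abs_aefun f"
  using assms by (metis aefun_cases abs_aefun_mem_L2_iff)

lemma neg_tempered_integral_abs:
  assumes "f \<in> borel_measurable borel"
  shows "neg_tempered_integral a lam (abs_aefun f)
    = abs_aefun (\<lambda>t. 1 / Gamma a * corr (tempered_kernel lam a) f t)"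
  using assms
  by (simp add: neg_tempered_integral.abs_eq ae_eq_refl corr_def tempered_kernel_def mult.assoc)

lemma subspace_L2: "subspace L2"
proof (rule subspaceI)
  show "0 \<in> L2"
    unfolding abs_aefun_zero by (subst abs_aefun_mem_L2_iff) (simp_all add: sq_integrable_def)
next
  fix F G assume "F \<in> L2" "G \<in> L2"
  then obtain f g where f: "sq_integrable f" "F = abs_aefun f" and g: "sq_integrable g" "G = abs_aefun g"
    by (metis L2_cases)
  show "F + G \<in> L2"
    unfolding f g abs_aefun_add[OF f(1)[THEN sq_integrable_measurable] g(1)[THEN sq_integrable_measurable]]
    using sq_integrable_add[OF f(1) g(1)] abs_aefun_mem_L2_iff sq_integrable_measurable by blast
next
  fix c :: real and F assume "F \<in> L2"
  then obtain f where f: "sq_integrable f" "F = abs_aefun f"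
    by (metis L2_cases)
  show "c *\<^sub>R F \<in> L2"
    unfolding f abs_aefun_scale[OF f(1)[THEN sq_integrable_measurable]]
    using sq_integrable_scale[OF f(1)] abs_aefun_mem_L2_iff sq_integrable_measurable by blast
qed

text \<open>
  The tempered kernel is integrable for \<open>lam > 0\<close>, so by Young's inequality the second condition in the
  definition holds for every square integrable function.
\<close>

lemma A1_eq_L2:
  assumes "1/2 < H" "0 < lam"
  shows "A1 H lam = L2"
proof -
  let ?a = "H - 1/2"
  have "neg_tempered_integral ?a lam F \<in> L2" if F: "F \<in> L2" for F
  proof -
    obtain f where f: "sq_integrable f" "F = abs_aefun f" using F by (rule L2_cases)
    note [measurable] = sq_integrable_measurable[OF f(1)]
    have "sq_integrable (\<lambda>t. 1 / Gamma ?a * corr (tempered_kernel lam ?a) f t)"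
      using assms by (intro sq_integrable_scale sq_integrable_corr f integrable_tempered_kernel tempered_kernel_nonneg) auto
    then show ?thesis
      by (simp only: f neg_tempered_integral_abs sq_integrable_measurable abs_aefun_mem_L2_iff)
  qed
  then show ?thesis unfolding A1_def L2_def by auto
qed

lemma A1_inner_abs:
  assumes "1/2 < H" and f: "f \<in> borel_measurable borel" and g: "g \<in> borel_measurable borel"
  shows "A1_inner H lam (abs_aefun f) (abs_aefun g) = (LINT t|lborel.
    corr (tempered_kernel lam (H - 1/2)) f t * corr (tempered_kernel lam (H - 1/2)) g t)"
proof -
  let ?a = "H - 1/2"
  note [measurable] = f g
  have "0 < Gamma ?a" by (rule Gamma_real_pos) (use assms(1) in simp)
  then have nz: "Gamma ?a \<noteq> 0" by simp
  have "Gamma ?a *\<^sub>R neg_tempered_integral ?a lam (abs_aefun h) = abs_aefun (corr (tempered_kernel lam ?a) h)"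
    if [measurable]: "h \<in> borel_measurable borel" for h
    using nz by (simp add: neg_tempered_integral_abs abs_aefun_scale)
  then show ?thesis
    by (simp add: A1_inner_def f g L2_inner.abs_eq ae_eq_refl)
qed

lemma A1_dist_abs:
  assumes "1/2 < H" "0 < lam" "sq_integrable f" "sq_integrable g"
  shows "A1_dist H lam (abs_aefun f) (abs_aefun g) = sqrt (LINT t|lborel.
    (corr (tempered_kernel lam (H - 1/2)) f t - corr (tempered_kernel lam (H - 1/2)) g t)\<^sup>2)"
proof -
  let ?k = "tempered_kernel lam (H - 1/2)"
  note [measurable] = assms(3,4)[THEN sq_integrable_measurable]
  have "AE t in lborel. corr ?k (\<lambda>u. f u - g u) t = corr ?k f t - corr ?k g t"
    using assms by (intro AE_corr_diff AE_integrable_corr integrable_tempered_kernel tempered_kernel_nonneg) auto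
  then have "(LINT t|lborel. (corr ?k (\<lambda>u. f u - g u) t)\<^sup>2) = (LINT t|lborel. (corr ?k f t - corr ?k g t)\<^sup>2)"
    by (intro integral_cong_AE) (auto elim: eventually_mono)
  then show ?thesis
    using assms(1) by (simp add: A1_dist_def abs_aefun_diff A1_inner_abs power2_eq_square)
qed

text \<open>
  Bilinearity holds because the correlations are linear almost everywhere; definiteness is the
  injectivity of the fractional integral.
\<close>

lemma A1_inner_product:
  assumes "1/2 < H" "H < 3/2" "0 < lam"
  shows "is_inner_product_on (A1 H lam) (A1_inner H lam)"
  unfolding A1_eq_L2[OF assms(1,3)] is_inner_product_on_def
proof (intro conjI ballI allI impI)
  let ?k = "tempered_kernel lam (H - 1/2)"
  have k: "integrable lborel ?k" "\<And>x. 0 \<le> ?k x"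
    using assms by (auto intro: integrable_tempered_kernel tempered_kernel_nonneg)
  note inner = A1_inner_abs[OF assms(1) sq_integrable_measurable sq_integrable_measurable]
  note corr = sq_integrable_corr[OF _ k]
  {
    fix F G assume "F \<in> L2" "G \<in> L2"
    then obtain f g where f: "sq_integrable f" "F = abs_aefun f" and g: "sq_integrable g" "G = abs_aefun g"
      by (metis L2_cases)
    show "A1_inner H lam F G = A1_inner H lam G F"
      by (simp add: f g inner mult.commute)
    fix c
    note [measurable] = f(1)[THEN sq_integrable_measurable] g(1)[THEN sq_integrable_measurable]
    show "A1_inner H lam (c *\<^sub>R F) G = c * A1_inner H lam F G"
      using assms(1) by (simp add: f(2) g(2) abs_aefun_scale A1_inner_abs corr_scale mult.assoc)
  next
    fix F G K assume "F \<in> L2" "G \<in> L2" "K \<in> L2"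
    then obtain f g h where f: "sq_integrable f" "F = abs_aefun f" and g: "sq_integrable g" "G = abs_aefun g"
      and h: "sq_integrable h" "K = abs_aefun h"
      by (metis L2_cases)
    note [measurable] = f(1)[THEN sq_integrable_measurable] g(1)[THEN sq_integrable_measurable]
      h(1)[THEN sq_integrable_measurable]
    have "AE t in lborel. corr ?k (\<lambda>u. f u + g u) t = corr ?k f t + corr ?k g t"
      by (intro AE_corr_add AE_integrable_corr f g k)
    then have "(LINT t|lborel. corr ?k (\<lambda>u. f u + g u) t * corr ?k h t)
        = (LINT t|lborel. corr ?k f t * corr ?k h t + corr ?k g t * corr ?k h t)"
      by (intro integral_cong_AE) (auto elim!: eventually_mono simp: distrib_right)
    also have "\<dots> = (LINT t|lborel. corr ?k f t * corr ?k h t) + (LINT t|lborel. corr ?k g t * corr ?k h t)"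
      by (intro Bochner_Integration.integral_add sq_integrable_mult corr f g h)
    finally show "A1_inner H lam (F + G) K = A1_inner H lam F K + A1_inner H lam G K"
      using assms(1) by (simp add: f(2) g(2) h(2) abs_aefun_add A1_inner_abs)
  next
    fix F assume "F \<in> L2"
    then obtain f where f: "sq_integrable f" "F = abs_aefun f"
      by (metis L2_cases)
    then show "0 \<le> A1_inner H lam F F" by (simp add: inner)
    note [measurable] = f(1)[THEN sq_integrable_measurable]
    assume "A1_inner H lam F F = 0"
    then have "(LINT t|lborel. (corr ?k f t)\<^sup>2) = 0" by (simp add: f inner power2_eq_square)
    then have "AE t in lborel. (corr ?k f t)\<^sup>2 = 0"
      using corr[OF f(1)] by (subst (asm) integral_nonneg_eq_0_iff_AE) (auto simp: sq_integrable_def)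
    then have "AE t in lborel. corr ?k f t = 0" by simp
    then have "AE u in lborel. f u = 0"
      using assms f by (intro corr_tempered_kernel_injective[of "H - 1/2" f lam]
          integrable_tempered_kernel_one_if_sq_integrable) auto
    then show "F = 0" by (simp add: f abs_aefun_zero abs_aefun_eq_iff)
  }
qed

section \<open>The metric of the class\<close>

text \<open>
  The usual passage from an inner product to a metric by the Cauchy--Schwarz inequality. The metric
  space locale asks for nonnegativity and symmetry of the distance also outside the carrier, about which
  \<open>is_inner_product_on\<close> says nothing; the last two hypotheses supply this.
\<close>

lemma Metric_space_if_inner_product:
  assumes V: "subspace V" and ip: "is_inner_product_on V ip"
    and nonneg: "\<And>x. 0 \<le> ip x x" and minus: "\<And>x y. ip (x - y) (x - y) = ip (y - x) (y - x)"
  shows "Metric_space V (\<lambda>x y. sqrt (ip (x - y) (x - y)))"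
proof -
  note ax = ip[unfolded is_inner_product_on_def]
  note sym = ax[THEN conjunct1, rule_format]
    and add = ax[THEN conjunct2, THEN conjunct1, rule_format]
    and scale = ax[THEN conjunct2, THEN conjunct2, THEN conjunct1, rule_format]
    and def = ax[THEN conjunct2, THEN conjunct2, THEN conjunct2, THEN conjunct2, rule_format]
  have expand: "ip (x + c *\<^sub>R y) (x + c *\<^sub>R y) = ip x x + 2 * c * ip x y + c\<^sup>2 * ip y y"
    if "x \<in> V" "y \<in> V" for x y c
  proof -
    have cy: "c *\<^sub>R y \<in> V" and s: "x + c *\<^sub>R y \<in> V" using V that by (auto intro: subspace_add subspace_scale)
    have "ip (x + c *\<^sub>R y) (x + c *\<^sub>R y) = ip (x + c *\<^sub>R y) x + c * ip (x + c *\<^sub>R y) y"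
      using add[OF that(1) cy s] scale[OF that(2) s, of c] sym[OF that(1) s] sym[OF that(2) s] by simp
    also have "\<dots> = (ip x x + c * ip x y) + c * (ip x y + c * ip y y)"
      using add[OF that(1) cy that(1)] add[OF that(1) cy that(2)]
        scale[OF that(2,1), of c] scale[OF that(2,2), of c] sym[OF that] by simp
    finally show ?thesis by (simp add: power2_eq_square algebra_simps)
  qed
  have CS: "(ip x y)\<^sup>2 \<le> ip x x * ip y y" if xy: "x \<in> V" "y \<in> V" for x y
  proof (cases "ip y y = 0")
    case True
    then have "y = 0 *\<^sub>R x" using def[OF xy(2)] by simp
    then have "ip y x = 0" using scale[OF xy(1) xy(1), of 0] by simp
    then show ?thesis using sym[OF xy] True by simp
  next
    case False
    then have p: "0 < ip y y" using nonneg[of y] by simp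
    \<comment> \<open>The coefficient is that of the orthogonal projection of \<open>x\<close> onto \<open>y\<close>.\<close>
    have "0 \<le> ip x x + 2 * (- ip x y / ip y y) * ip x y + (- ip x y / ip y y)\<^sup>2 * ip y y"
      unfolding expand[OF xy, symmetric] by (rule nonneg)
    also have "\<dots> = ip x x - (ip x y)\<^sup>2 / ip y y"
      using False by (simp add: power2_eq_square field_simps)
    finally show ?thesis using p by (simp add: pos_divide_le_eq)
  qed
  have tri: "sqrt (ip (x + y) (x + y)) \<le> sqrt (ip x x) + sqrt (ip y y)" if xy: "x \<in> V" "y \<in> V" for x y
  proof (rule real_le_lsqrt)
    have "ip x y \<le> sqrt (ip x x * ip y y)"
      using CS[OF xy] by (rule real_le_rsqrt)
    then show "ip (x + y) (x + y) \<le> (sqrt (ip x x) + sqrt (ip y y))\<^sup>2"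
      using expand[OF xy, of 1] nonneg by (simp add: power2_sum real_sqrt_mult)
  qed (use nonneg in auto)
  show ?thesis
  proof
    fix x y show "0 \<le> sqrt (ip (x - y) (x - y))" using nonneg by simp
    show "sqrt (ip (x - y) (x - y)) = sqrt (ip (y - x) (y - x))" using minus[of x y] by simp
  next
    fix x y assume xy: "x \<in> V" "y \<in> V"
    have "ip 0 0 = 0" using scale[OF xy(1) subspace_0[OF V], of 0] by simp
    then show "sqrt (ip (x - y) (x - y)) = 0 \<longleftrightarrow> x = y"
      using def[OF subspace_diff[OF V xy]] by auto
  next
    fix x y z assume xyz: "x \<in> V" "y \<in> V" "z \<in> V"
    show "sqrt (ip (x - z) (x - z)) \<le> sqrt (ip (x - y) (x - y)) + sqrt (ip (y - z) (y - z))"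
      using tri[OF subspace_diff[OF V xyz(1,2)] subspace_diff[OF V xyz(2,3)]] by simp
  qed
qed

lemma Metric_space_A1:
  assumes "1/2 < H" "H < 3/2" "0 < lam"
  shows "Metric_space (A1 H lam) (A1_dist H lam)"
proof -
  have "0 \<le> A1_inner H lam F F" for F
  proof -
    obtain f where "f \<in> borel_measurable borel" "F = abs_aefun f" by (rule aefun_cases)
    then show ?thesis using assms(1) by (simp add: A1_inner_abs)
  qed
  moreover have "A1_inner H lam (F - G) (F - G) = A1_inner H lam (G - F) (G - F)" for F G
  proof -
    obtain f where f: "f \<in> borel_measurable borel" "F - G = abs_aefun f" by (rule aefun_cases)
    have "G - F = (-1) *\<^sub>R (F - G)" by simp
    also have "\<dots> = abs_aefun (\<lambda>x. (-1) * f x)" unfolding f(2) using f(1) by (rule abs_aefun_scale)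
    finally have "G - F = abs_aefun (\<lambda>x. (-1) * f x)" .
    then show ?thesis
      using assms(1) f by (simp only: A1_inner_abs borel_measurable_times borel_measurable_const corr_scale) simp
  qed
  moreover have "subspace (A1 H lam)" using assms by (simp add: A1_eq_L2 subspace_L2)
  ultimately have "Metric_space (A1 H lam) (\<lambda>F G. sqrt (A1_inner H lam (F - G) (F - G)))"
    by (intro Metric_space_if_inner_product A1_inner_product assms)
  then show ?thesis by (simp add: A1_dist_def[abs_def])
qed

lemma elementary_space_subset_L2: "elementary_space \<subseteq> L2"
  unfolding elementary_space_def
  using abs_aefun_mem_L2_iff elementary_sq_integrable sq_integrable_measurable by blast

text \<open>
  By Young's inequality the metric is bounded by a multiple of the \<open>L\<^sup>2\<close> distance, for which the
  elementary functions are dense.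
\<close>

lemma closure_of_elementary_space:
  assumes "1/2 < H" "H < 3/2" "0 < lam"
  shows "Metric_space.mtopology (A1 H lam) (A1_dist H lam) closure_of elementary_space = A1 H lam"
proof -
  interpret Metric_space "A1 H lam" "A1_dist H lam" using assms by (rule Metric_space_A1)
  let ?k = "tempered_kernel lam (H - 1/2)"
  have k: "integrable lborel ?k" "\<And>x. 0 \<le> ?k x"
    using assms by (auto intro: integrable_tempered_kernel tempered_kernel_nonneg)
  have "\<exists>E\<in>elementary_space. E \<in> mball F r" if F: "F \<in> A1 H lam" and r: "0 < r" for F r
  proof -
    obtain f where f: "sq_integrable f" "F = abs_aefun f"
      using F assms by (metis A1_eq_L2 L2_cases)
    \<comment> \<open>The summand 1 only makes the constant positive.\<close>
    define K where "K = (LINT x|lborel. ?k x)\<^sup>2 + 1"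
    have K: "0 < K" by (simp add: K_def add_nonneg_pos)
    then have "0 < r\<^sup>2 / K" using r by simp
    then obtain e where e: "elementary e" "(LINT x|lborel. (f x - e x)\<^sup>2) < r\<^sup>2 / K"
      using sq_integrable_imp_step_approximable[OF f(1)] unfolding step_approximable_def by blast
    note sq = f(1) elementary_sq_integrable[OF e(1)]
    have dist: "A1_dist H lam F (abs_aefun e)
        = sqrt (LINT t|lborel. (corr ?k (\<lambda>u. f u - e u) t)\<^sup>2)"
      using assms(1) sq[THEN sq_integrable_measurable]
      by (simp add: f(2) A1_dist_def abs_aefun_diff A1_inner_abs power2_eq_square)
    have "(LINT t|lborel. (corr ?k (\<lambda>u. f u - e u) t)\<^sup>2)
        \<le> (LINT x|lborel. ?k x)\<^sup>2 * (LINT x|lborel. (f x - e x)\<^sup>2)"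
      by (intro integral_corr_square_le sq_integrable_diff sq k)
    also have "\<dots> \<le> K * (LINT x|lborel. (f x - e x)\<^sup>2)"
      by (intro mult_right_mono) (auto simp: K_def)
    also have "\<dots> < r\<^sup>2" using e(2) K by (simp add: pos_less_divide_eq mult.commute)
    finally have "A1_dist H lam F (abs_aefun e) < r"
      unfolding dist using r by (intro real_less_lsqrt) auto
    moreover have E: "abs_aefun e \<in> elementary_space" using e(1) by (simp add: elementary_space_def)
    moreover have "abs_aefun e \<in> A1 H lam"
      using E elementary_space_subset_L2 unfolding A1_eq_L2[OF assms(1,3)] by blast
    ultimately show ?thesis using F by (intro bexI[of _ "abs_aefun e"]) (simp_all add: in_mball)
  qed
  then show ?thesis unfolding metric_closure_of by auto
qed

text \<open>
  Let \<open>f\<close> be the reflection of \<open>k\<^sub>1\<^sub>/\<^sub>2\<close>. It misses \<open>L\<^sup>2\<close> by a logarithm, but its correlation is a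
  multiple of the reflection of \<open>k\<^sub>H\<close>, which is in \<open>L\<^sup>2\<close>. The truncations of \<open>f\<close> are therefore a Cauchy
  sequence, whose limit in the class would have the same fractional integral as \<open>f\<close> and hence, by
  injectivity, would equal \<open>f\<close>.
\<close>

lemma not_mcomplete_A1:
  assumes H: "1/2 < H" "H < 3/2" and lam: "0 < lam"
  shows "\<not> Metric_space.mcomplete (A1 H lam) (A1_dist H lam)"
proof
  interpret Metric_space "A1 H lam" "A1_dist H lam" using assms by (rule Metric_space_A1)
  assume complete: mcomplete
  let ?a = "H - 1/2"
  let ?k = "tempered_kernel lam ?a"
  have k: "integrable lborel ?k" "\<And>x. 0 \<le> ?k x"
    using assms by (auto intro: integrable_tempered_kernel tempered_kernel_nonneg)
  define f where "f u = tempered_kernel lam (1/2) (- u)" for u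
  have [measurable]: "f \<in> borel_measurable borel" unfolding f_def[abs_def] by measurable
  have f0: "0 \<le> f u" for u by (simp add: f_def tempered_kernel_nonneg)
  have f_int: "integrable lborel f"
    using lborel_integrable_real_affine[OF integrable_tempered_kernel[OF lam, of "1/2"], of "-1" 0]
    by (simp add: f_def[abs_def])
  have fk: "integrable lborel (\<lambda>u. f u * ?k (u - t))" for t
    unfolding f_def using H by (intro corr_reflected_tempered_kernel) auto
  have f_tail: "integrable lborel (\<lambda>u. f u * tempered_kernel lam 1 (u - t))" for t
    unfolding f_def by (intro corr_reflected_tempered_kernel) auto
  have "sq_integrable (\<lambda>t. Beta (1/2) ?a * tempered_kernel lam (1/2 + ?a) (0 - t))"
    using H lam by (intro sq_integrable_scale sq_integrable_reflect sq_integrable_tempered_kernel) auto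
  moreover have "corr ?k f t = Beta (1/2) ?a * tempered_kernel lam (1/2 + ?a) (0 - t)" for t
    unfolding f_def diff_0 using H by (intro corr_reflected_tempered_kernel) auto
  ultimately have Tf: "sq_integrable (corr ?k f)" by presburger
  define fn where "fn n u = min (f u) (real n)" for n u
  have fn: "sq_integrable (fn n)" for n
    unfolding fn_def[abs_def] using f_int f0 by (rule sq_integrable_truncation)
  have Tfn: "sq_integrable (corr ?k (fn n))" for n using fn k by (rule sq_integrable_corr)
  define \<delta> where "\<delta> n = (LINT t|lborel. (corr ?k f t - corr ?k (fn n) t)\<^sup>2)" for n
  have \<delta>: "\<delta> \<longlonglongrightarrow> 0"
    unfolding \<delta>_def[abs_def] fn_def[abs_def]
    by (rule corr_truncations_tendsto[OF f_int f0 _ k(2) fk Tf]) measurable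
  define \<sigma> where "\<sigma> n = abs_aefun (fn n)" for n
  have \<sigma>: "\<sigma> n \<in> A1 H lam" for n
    using abs_aefun_mem_L2_iff[OF sq_integrable_measurable] fn H lam by (simp add: \<sigma>_def A1_eq_L2)
  have "MCauchy \<sigma>"
    unfolding MCauchy_def
  proof (intro conjI allI impI)
    show "range \<sigma> \<subseteq> A1 H lam" using \<sigma> by auto
    fix \<epsilon> :: real assume "0 < \<epsilon>"
    then have "\<forall>\<^sub>F n in sequentially. \<delta> n < \<epsilon>\<^sup>2 / 4" using \<delta> by (intro order_tendstoD) auto
    then obtain N where N: "\<delta> n < \<epsilon>\<^sup>2 / 4" if "N \<le> n" for n by (auto simp: eventually_sequentially)
    have "A1_dist H lam (\<sigma> n) (\<sigma> m) < \<epsilon>" if "N \<le> n" "N \<le> m" for n m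
    proof -
      have "(LINT t|lborel. (corr ?k (fn n) t - corr ?k (fn m) t)\<^sup>2)
          \<le> 2 * (LINT t|lborel. (corr ?k (fn n) t - corr ?k f t)\<^sup>2) + 2 * \<delta> m"
        unfolding \<delta>_def by (intro square_dist_triangle Tf Tfn)
      also have "(LINT t|lborel. (corr ?k (fn n) t - corr ?k f t)\<^sup>2) = \<delta> n"
        by (simp add: \<delta>_def power2_commute)
      also have "2 * \<delta> n + 2 * \<delta> m < \<epsilon>\<^sup>2" using N[OF that(1)] N[OF that(2)] by simp
      finally show ?thesis
        unfolding \<sigma>_def A1_dist_abs[OF H(1) lam fn fn]
        using \<open>0 < \<epsilon>\<close> by (intro real_less_lsqrt) auto
    qed
    then show "\<exists>N. \<forall>n n'. N \<le> n \<longrightarrow> N \<le> n' \<longrightarrow> A1_dist H lam (\<sigma> n) (\<sigma> n') < \<epsilon>" by blast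
  qed
  then obtain G where "limitin mtopology \<sigma> G sequentially" using complete unfolding mcomplete_def by blast
  then have GA: "G \<in> A1 H lam" and lim: "\<And>\<epsilon>. 0 < \<epsilon> \<Longrightarrow> \<forall>\<^sub>F n in sequentially. A1_dist H lam (\<sigma> n) G < \<epsilon>"
    by (auto simp: limitin_metric elim: eventually_mono)
  obtain g where g: "sq_integrable g" "G = abs_aefun g"
    using GA H lam by (metis A1_eq_L2 L2_cases)
  note [measurable] = sq_integrable_measurable[OF g(1)]
  have Tg: "sq_integrable (corr ?k g)" using g(1) k by (rule sq_integrable_corr)
  have "(LINT t|lborel. (corr ?k f t - corr ?k g t)\<^sup>2) \<le> 0"
  proof (rule field_le_epsilon)
    fix \<epsilon> :: real assume \<epsilon>: "0 < \<epsilon>"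
    have "\<forall>\<^sub>F n in sequentially. \<delta> n < \<epsilon> / 4" using \<delta> \<epsilon> by (intro order_tendstoD) auto
    moreover have "\<forall>\<^sub>F n in sequentially. A1_dist H lam (\<sigma> n) G < sqrt (\<epsilon> / 4)" using \<epsilon> by (intro lim) simp
    ultimately have "\<forall>\<^sub>F n in sequentially. \<delta> n < \<epsilon> / 4 \<and> A1_dist H lam (\<sigma> n) G < sqrt (\<epsilon> / 4)"
      by (rule eventually_conj)
    then obtain n where n: "\<delta> n < \<epsilon> / 4" "A1_dist H lam (\<sigma> n) G < sqrt (\<epsilon> / 4)"
      by (auto simp: eventually_sequentially)
    have "(LINT t|lborel. (corr ?k (fn n) t - corr ?k g t)\<^sup>2) < \<epsilon> / 4"
      using n(2) unfolding \<sigma>_def g(2) A1_dist_abs[OF H(1) lam fn g(1)] by simp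
    then show "(LINT t|lborel. (corr ?k f t - corr ?k g t)\<^sup>2) \<le> 0 + \<epsilon>"
      using square_dist_triangle[OF Tf Tfn Tg, of n] n(1) unfolding \<delta>_def by linarith
  qed
  then have "(LINT t|lborel. (corr ?k f t - corr ?k g t)\<^sup>2) = 0"
    by (intro antisym) auto
  then have "AE t in lborel. (corr ?k f t - corr ?k g t)\<^sup>2 = 0"
    using sq_integrable_diff[OF Tf Tg]
    by (subst (asm) integral_nonneg_eq_0_iff_AE) (auto simp: sq_integrable_def)
  moreover have "AE t in lborel. corr ?k (\<lambda>u. f u - g u) t = corr ?k f t - corr ?k g t"
    using fk AE_integrable_corr[OF g(1) k] by (intro AE_corr_diff) auto
  ultimately have "AE t in lborel. corr ?k (\<lambda>u. f u - g u) t = 0"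
    by eventually_elim simp
  moreover have "integrable lborel (\<lambda>u. (f u - g u) * tempered_kernel lam 1 (u - t))" for t
    using f_tail[of t] integrable_tempered_kernel_one_if_sq_integrable[OF lam g(1), of t]
    by (simp add: left_diff_distrib)
  ultimately have "AE u in lborel. f u - g u = 0"
    using H by (intro corr_tempered_kernel_injective[of ?a "\<lambda>u. f u - g u" lam]) auto
  then have "sq_integrable f"
    by (intro sq_integrable_mono[OF g(1)]) (auto elim: eventually_mono)
  then have "sq_integrable (\<lambda>u. f (0 - u))" by (rule sq_integrable_reflect)
  then show False
    using not_sq_integrable_tempered_kernel_half[OF lam] by (simp add: f_def)
qed

theorem theorem3p2:
  fixes H lam :: real
  assumes "1/2 < H" and "H < 1" and "0 < lam"
  shows "subspace (A1 H lam)
    \<and> is_inner_product_on (A1 H lam) (A1_inner H lam)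
    \<and> elementary_space \<subseteq> A1 H lam
    \<and> Metric_space.mtopology (A1 H lam) (A1_dist H lam) closure_of elementary_space = A1 H lam
    \<and> \<not> Metric_space.mcomplete (A1 H lam) (A1_dist H lam)"
proof (intro conjI)
  have H: "H < 3/2" using assms(2) by simp
  have L2: "A1 H lam = L2" using assms by (simp add: A1_eq_L2)
  show "subspace (A1 H lam)" unfolding L2 by (rule subspace_L2)
  show "is_inner_product_on (A1 H lam) (A1_inner H lam)"
    using assms(1) H assms(3) by (rule A1_inner_product)
  show "elementary_space \<subseteq> A1 H lam" unfolding L2 by (rule elementary_space_subset_L2)
  show "Metric_space.mtopology (A1 H lam) (A1_dist H lam) closure_of elementary_space = A1 H lam"
    using assms(1) H assms(3) by (rule closure_of_elementary_space)
  show "\<not> Metric_space.mcomplete (A1 H lam) (A1_dist H lam)"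
    using assms(1) H assms(3) by (rule not_mcomplete_A1)
qed

end
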